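(* For any discrete random variable $X$ and any $n\in\mathbb{N}$, there exist i.i.d. discrete random variables $Z_1,\ldots,Z_n$ and a function $f$ such that $X\stackrel{d}{=}f(Z_1,\ldots,Z_n)$ and $$H(Z_1)\le\frac{1}{1-(1-n^{-1})^{n}}\cdot\frac{H(X)}{n}+\min\left\{2.43,\;H_{\mathrm b}\left(\min\left\{\sqrt{\frac{e}{(e-1)\log e}\cdot\frac{H(X)}{n}},\,\frac12\right\}\right)+H_{\mathrm b}(2^{-1/n})+2(1-2^{-1/n})\right\}.$$
   Context: $\mathbb{N}=\{1,2,3,\ldots\}$. All logarithms $\log$ are to base $2$ (so $\log e=\log_2 e$). $H(X)=-\sum_x p_X(x)\log p_X(x)$ is the Shannon entropy in bits of a discrete (finite or countable support) random variable with probability mass function $p_X$. $H_{\mathrm b}(x):=-x\log x-(1-x)\log(1-x)$ is the binary entropy function (with $0\log 0=0$). $X\stackrel{d}{=}Y$ means that $X$ and $Y$ have the same distribution. *)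

theory Defs
  imports "HOL-Probability.Probability"
begin

text \<open>
  Values of a discrete random variable carry the power-set sigma-algebra. The value type may be
  uncountable; discreteness then means that the law is concentrated on a countable set.
\<close>

definition discrete_rv :: "'a measure \<Rightarrow> ('a \<Rightarrow> 'b) \<Rightarrow> bool" where
  "discrete_rv M X \<longleftrightarrow>
     X \<in> M \<rightarrow>\<^sub>M count_space UNIV \<and> (\<exists>S. countable S \<and> (AE \<omega> in M. X \<omega> \<in> S))"

definition rv_pmf :: "'a measure \<Rightarrow> ('a \<Rightarrow> 'b) \<Rightarrow> 'b \<Rightarrow> real" where
  "rv_pmf M X x = measure M {\<omega> \<in> space M. X \<omega> = x}"

text \<open>
  Entropy in bits, in \<open>[0, \<infinity>]\<close>: a countably supported law may have infinite entropy, whereas the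
  real-valued library constant \<open>entropy\<close> is a Bochner integral and would then return \<open>0\<close>.
  Every summand is nonnegative because \<open>rv_pmf M X x \<le> 1\<close>, so \<open>ennreal\<close> does not truncate, and
  values of probability \<open>0\<close> contribute \<open>0\<close>.
\<close>

definition shannon_entropy :: "'a measure \<Rightarrow> ('a \<Rightarrow> 'b) \<Rightarrow> ennreal" where
  "shannon_entropy M X = (\<Sum>\<^sub>\<infinity>x\<in>UNIV. ennreal (- rv_pmf M X x * log 2 (rv_pmf M X x)))"

text \<open>The convention \<open>0 log 0 = 0\<close> is automatic at both endpoints.\<close>

definition binary_entropy :: "real \<Rightarrow> real" where
  "binary_entropy x = - x * log 2 x - (1 - x) * log 2 (1 - x)"

definition ennreal_sqrt :: "ennreal \<Rightarrow> ennreal" where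
  "ennreal_sqrt x = (if x = \<infinity> then \<infinity> else ennreal (sqrt (enn2real x)))"

definition same_distribution :: "'a measure \<Rightarrow> ('a \<Rightarrow> 'c) \<Rightarrow> 'b measure \<Rightarrow> ('b \<Rightarrow> 'c) \<Rightarrow> bool" where
  "same_distribution M X N Y \<longleftrightarrow> distr M (count_space UNIV) X = distr N (count_space UNIV) Y"

definition iid_discrete :: "'a measure \<Rightarrow> 'i set \<Rightarrow> ('i \<Rightarrow> 'a \<Rightarrow> 'b) \<Rightarrow> bool" where
  "iid_discrete M I Z \<longleftrightarrow>
     (\<forall>i\<in>I. discrete_rv M (Z i)) \<and>
     prob_space.indep_vars M (\<lambda>_. count_space UNIV) Z I \<and>
     (\<forall>i\<in>I. \<forall>j\<in>I. same_distribution M (Z i) M (Z j))"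

end

theory Submission
  imports Defs
begin

text \<open>
  Suppose the cells of an i.i.d. sequence \<open>W\<^sub>1, \<dots>, W\<^sub>n\<close> are stochastically no heavier than the atoms
  of \<open>X\<close>. Lay both families out on the unit interval in decreasing order. Then no cell contains
  two division points of \<open>X\<close>, so \<open>X\<close> is a function of the cell and of one biased coin. A coin of
  any bias can be read off a single geometric variable of parameter \<open>1 / 2\<close>, which is the maximum of
  \<open>n\<close> i.i.d. variables of entropy at most \<open>H\<^sub>b (2 powr (- 1 / n)) + 2 (1 - 2 powr (- 1 / n))\<close>, and
  at most \<open>1.43\<close> if \<open>n \<ge> 2\<close>.

  To find \<open>W\<close>, let \<open>\<iota>\<close> be the information of \<open>X\<close> and \<open>k\<close> its quantile at level \<open>(1 - 1 / n) ^ n\<close>.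
  It is enough that each component carries information at least \<open>k / n\<close> plus the positive part of
  \<open>\<iota> - k\<close> taken at a level whose maximum over the components is uniform. The mean of this quantity is
  at most \<open>h = H(X) / n / (1 - (1 - 1 / n) ^ n)\<close>. Rounding it greedily to the information of an actual
  law with largest atom \<open>w\<close> costs at most \<open>H\<^sub>b w\<close>, by the log-sum inequality, and
  \<open>(1 - w)\<^sup>2 log e \<le> (1 - w) log (1 / w) \<le> h\<close>. If \<open>n = 1\<close> or \<open>H(X) = \<infinity>\<close>, independent copies of
  \<open>X\<close> suffice.
\<close>

subsection \<open>Entropy of probability mass functions\<close>

definition pmf_entropy :: "'a pmf \<Rightarrow> ennreal" where
  "pmf_entropy p = (\<integral>\<^sup>+x. ennreal (- log 2 (pmf p x)) \<partial>measure_pmf p)"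

text \<open>Bridges the unordered sum in \<open>shannon_entropy\<close> and integration. Enumerating
  the countable support turns the integral into a series whose partial sums are finite
  subsums.\<close>

lemma nn_integral_count_space_eq_infsum:
  fixes g :: "'a \<Rightarrow> ennreal"
  assumes "countable {x. g x \<noteq> 0}"
  shows "(\<integral>\<^sup>+x. g x \<partial>count_space UNIV) = infsum g UNIV"
proof (rule antisym)
  let ?S = "{x. g x \<noteq> 0}"
  have fin: "sum g F \<le> infsum g UNIV" if "finite F" for F
    using that by (subst nonneg_infsum_complete) (auto intro!: SUP_upper)
  show "(\<integral>\<^sup>+x. g x \<partial>count_space UNIV) \<le> infsum g UNIV"
  proof (cases "finite ?S")
    case True
    have "(\<integral>\<^sup>+x. g x \<partial>count_space UNIV) = sum g ?S"
      by (rule nn_integral_count_space'[OF True]) auto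
    with fin[OF True] show ?thesis by simp
  next
    case False
    let ?e = "from_nat_into ?S"
    have bij: "bij_betw ?e UNIV ?S"
      using assms False by (rule bij_betw_from_nat_into)
    have "(\<integral>\<^sup>+x. g x \<partial>count_space UNIV) = (\<integral>\<^sup>+x. g x \<partial>count_space ?S)"
      by (rule nn_integral_count_space_eq) auto
    also have "\<dots> = (\<integral>\<^sup>+k. g (?e k) \<partial>count_space UNIV)"
      using nn_integral_bij_count_space[OF bij] by simp
    also have "\<dots> = (\<Sum>k. g (?e k))"
      by (rule nn_integral_count_space_nat)
    also have "\<dots> \<le> infsum g UNIV"
    proof (rule suminf_le_const)
      fix m
      have "(\<Sum>k<m. g (?e k)) = sum g (?e ` {..<m})"
        using bij by (subst sum.reindex) (auto simp: bij_betw_def intro: inj_on_subset)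
      then show "(\<Sum>k<m. g (?e k)) \<le> infsum g UNIV"
        using fin[of "?e ` {..<m}"] by simp
    qed simp
    finally show ?thesis .
  qed
  show "infsum g UNIV \<le> (\<integral>\<^sup>+x. g x \<partial>count_space UNIV)"
  proof (subst nonneg_infsum_complete, simp, rule SUP_least)
    fix F :: "'a set" assume F: "F \<in> {F. finite F \<and> F \<subseteq> UNIV}"
    have "sum g F = (\<integral>\<^sup>+x. g x * indicator F x \<partial>count_space UNIV)"
      using F by (subst nn_integral_count_space'[where A=F]) (auto simp: indicator_def)
    also have "\<dots> \<le> (\<integral>\<^sup>+x. g x \<partial>count_space UNIV)"
      by (intro nn_integral_mono) (auto simp: indicator_def)
    finally show "sum g F \<le> (\<integral>\<^sup>+x. g x \<partial>count_space UNIV)" .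
  qed
qed

lemma pmf_entropy_altdef:
  "pmf_entropy p = (\<integral>\<^sup>+x. ennreal (- pmf p x * log 2 (pmf p x)) \<partial>count_space UNIV)"
  unfolding pmf_entropy_def nn_integral_measure_pmf
  by (intro nn_integral_cong)
     (auto simp: ennreal_mult'' [symmetric] ennreal_mult'[symmetric] pmf_nonneg)

lemma shannon_entropy_eq_pmf_entropy:
  assumes "\<And>x. rv_pmf M X x = pmf p x"
  shows "shannon_entropy M X = pmf_entropy p"
proof -
  have "countable {x. ennreal (- pmf p x * log 2 (pmf p x)) \<noteq> 0}"
    by (rule countable_subset[OF _ countable_set_pmf[of p]]) (auto simp: set_pmf_iff)
  then show ?thesis
    unfolding shannon_entropy_def pmf_entropy_altdef assms
    by (simp add: nn_integral_count_space_eq_infsum)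
qed

lemma pmf_entropy_map_inj:
  assumes "inj_on f (set_pmf p)"
  shows "pmf_entropy (map_pmf f p) = pmf_entropy p"
  unfolding pmf_entropy_def nn_integral_map_pmf
  by (intro nn_integral_cong_AE) (auto simp: AE_measure_pmf_iff pmf_map_inj[OF assms])

lemma pmf_entropy_pair: "pmf_entropy (pair_pmf p q) = pmf_entropy p + pmf_entropy q"
proof -
  have eq: "ennreal (- log 2 (pmf p x * pmf q y))
      = ennreal (- log 2 (pmf p x)) + ennreal (- log 2 (pmf q y))"
    if "x \<in> set_pmf p" "y \<in> set_pmf q" for x y
  proof -
    have "pmf p x > 0" "pmf q y > 0" using that by (auto simp: pmf_positive_iff)
    moreover have "log 2 (pmf p x) \<le> 0" "log 2 (pmf q y) \<le> 0"
      using calculation by (auto simp: pmf_le_1)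
    ultimately show ?thesis
      by (subst ennreal_plus[symmetric]) (auto simp: log_mult)
  qed
  have "pmf_entropy (pair_pmf p q) =
    (\<integral>\<^sup>+x. \<integral>\<^sup>+y. (ennreal (- log 2 (pmf p x)) + ennreal (- log 2 (pmf q y))) \<partial>q \<partial>p)"
    unfolding pmf_entropy_def nn_integral_pair_pmf' pmf_pair
    by (intro nn_integral_cong_AE AE_pmfI) (auto simp: eq)
  also have "\<dots> = pmf_entropy p + pmf_entropy q"
    by (simp add: nn_integral_add pmf_entropy_def)
  finally show ?thesis .
qed

text \<open>The terms are nonnegative, so each partial sum is bounded by all later
  \<open>b m\<close>. The limit discards the vanishing error terms that the Gibbs estimates below
  leave.\<close>

lemma pmf_entropy_nat_le:
  fixes p :: "nat pmf"
  assumes lim: "b \<longlonglongrightarrow> B"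
    and le: "\<And>m. (\<Sum>k<m. - pmf p k * log 2 (pmf p k)) \<le> b m"
  shows "pmf_entropy p \<le> ennreal B"
proof -
  let ?t = "\<lambda>k. - pmf p k * log 2 (pmf p k)"
  have nn: "?t k \<ge> 0" for k
  proof (cases "pmf p k = 0")
    case False
    then have "log 2 (pmf p k) \<le> 0" using pmf_nonneg[of p k] by (auto simp: pmf_le_1)
    then show ?thesis by (simp add: mult_nonneg_nonpos)
  qed simp
  have "sum ?t {..<m} \<le> B" for m
  proof (rule LIMSEQ_le_const[OF lim], intro exI allI impI)
    fix k assume "m \<le> k"
    then have "sum ?t {..<m} \<le> sum ?t {..<k}"
      by (intro sum_mono2) (use nn in auto)
    then show "sum ?t {..<m} \<le> b k" using le[of k] by simp
  qed
  then have "(\<Sum>k<m. ennreal (?t k)) \<le> ennreal B" for m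
    by (subst sum_ennreal[OF nn]) (auto intro: ennreal_leI)
  then have "(\<Sum>k. ennreal (?t k)) \<le> ennreal B"
    by (intro suminf_le_const) auto
  then show ?thesis
    unfolding pmf_entropy_altdef nn_integral_count_space_nat .
qed

section \<open>Gibbs' inequality and the binary entropy function\<close>

lemma log2_le_sub_one:
  fixes x :: real assumes "x > 0" shows "log 2 x \<le> (x - 1) * log 2 (exp 1)"
proof -
  have "ln x \<le> x - 1" by (rule ln_le_minus_one[OF assms])
  then show ?thesis by (simp add: log_def divide_right_mono)
qed

text \<open>Gibbs' inequality for two-point laws: the tangent-line corrections \<open>y - x\<close>
  and \<open>x - y\<close> cancel.\<close>

lemma binary_entropy_le_cross:
  assumes "0 \<le> x" "x \<le> 1" "0 < y" "y < 1"
  shows "binary_entropy x \<le> - x * log 2 y - (1 - x) * log 2 (1 - y)"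
proof -
  have *: "u * (log 2 v - log 2 u) \<le> (v - u) * log 2 (exp 1)" if "u \<ge> 0" "v > 0" for u v :: real
  proof (cases "u = 0")
    case True
    have "0 \<le> v * log 2 (exp 1)" using that by simp
    with True show ?thesis by simp
  next
    case False
    then have "log 2 v - log 2 u \<le> (v / u - 1) * log 2 (exp 1)"
      using that log2_le_sub_one[of "v / u"] by (simp add: log_divide)
    then have "u * (log 2 v - log 2 u) \<le> u * ((v / u - 1) * log 2 (exp 1))"
      using that by (intro mult_left_mono) auto
    also have "\<dots> = (v - u) * log 2 (exp 1)" using False by (simp add: field_simps)
    finally show ?thesis .
  qed
  have "x * (log 2 y - log 2 x) + (1 - x) * (log 2 (1 - y) - log 2 (1 - x)) \<le> 0"
  proof -
    have "x * (log 2 y - log 2 x) + (1 - x) * (log 2 (1 - y) - log 2 (1 - x))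
        \<le> (y - x) * log 2 (exp 1) + ((1 - y) - (1 - x)) * log 2 (exp 1)"
      using assms by (intro add_mono *) auto
    also have "\<dots> = 0" by (simp add: algebra_simps diff_divide_distrib)
    finally show ?thesis .
  qed
  then show ?thesis
    by (simp add: binary_entropy_def algebra_simps)
qed

text \<open>No derivative is taken: the cross entropy against \<open>y\<close> is affine in its
  first argument with nonnegative slope, equals the entropy at \<open>y\<close> and dominates it at
  \<open>x\<close>.\<close>

lemma binary_entropy_mono:
  assumes "0 \<le> x" "x \<le> y" "y \<le> 1 / 2"
  shows "binary_entropy x \<le> binary_entropy y"
proof (cases "y = 0")
  case True
  with assms show ?thesis by simp
next
  case False
  with assms have y: "0 < y" by simp
  have "log 2 y \<le> log 2 (1 - y)" using assms y by simp
  then have "0 \<le> (y - x) * (log 2 (1 - y) - log 2 y)" using assms by simp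
  then have "- x * log 2 y - (1 - x) * log 2 (1 - y) \<le> binary_entropy y"
    by (simp add: binary_entropy_def algebra_simps)
  moreover have "binary_entropy x \<le> - x * log 2 y - (1 - x) * log 2 (1 - y)"
    using assms y by (intro binary_entropy_le_cross) auto
  ultimately show ?thesis by simp
qed

lemma binary_entropy_half [simp]: "binary_entropy (1 / 2) = 1"
  by (simp add: binary_entropy_def log_divide)

lemma binary_entropy_le_1: "0 \<le> x \<Longrightarrow> x \<le> 1 \<Longrightarrow> binary_entropy x \<le> 1"
  using binary_entropy_le_cross[of x "1 / 2"] by (simp add: log_divide algebra_simps)

lemma binary_entropy_sym: "binary_entropy (1 - x) = binary_entropy x"
  by (simp add: binary_entropy_def algebra_simps)

lemma binary_entropy_nonneg:
  assumes "0 \<le> x" "x \<le> 1"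
  shows "binary_entropy x \<ge> 0"
proof -
  have *: "u * log 2 u \<le> 0" if "0 \<le> u" "u \<le> 1" for u :: real
    using that by (cases "u = 0") (auto simp: mult_nonneg_nonpos)
  from *[of x] *[of "1 - x"] assms show ?thesis by (simp add: binary_entropy_def)
qed

subsection \<open>Coupling of sorted atoms\<close>

lemma binary_digits_sum:
  fixes a :: real
  assumes "0 \<le> a" "a < 1"
  shows "(\<Sum>k<m. if odd \<lfloor>2 ^ (k + 1) * a\<rfloor> then (1 / 2) ^ (k + 1) else 0) = \<lfloor>2 ^ m * a\<rfloor> / 2 ^ m"
proof (induction m)
  case 0
  have "\<lfloor>a\<rfloor> = 0" using assms by (simp add: floor_eq_iff)
  then show ?case by simp
next
  case (Suc m)
  have "\<lfloor>2 * y\<rfloor> = 2 * \<lfloor>y\<rfloor> + (if odd \<lfloor>2 * y\<rfloor> then 1 else 0)" for y :: real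
  proof -
    have "2 * \<lfloor>y\<rfloor> \<le> \<lfloor>2 * y\<rfloor>" "\<lfloor>2 * y\<rfloor> \<le> 2 * \<lfloor>y\<rfloor> + 1" by linarith+
    then show ?thesis by (auto elim!: oddE evenE split: if_splits; presburger)
  qed
  from this[of "2 ^ m * a"] Suc show ?case
    by (auto simp: field_simps power_one_over split: if_splits)
qed

text \<open>The geometric law gives mass \<open>(1 / 2) ^ (k + 1)\<close> to \<open>k\<close>, so
  the places of the digits one in the binary expansion of \<open>a\<close> form the required set.
  For \<open>a = 1\<close> the floors are all even, whence the separate case.\<close>

lemma geometric_half_prob_surj:
  assumes "0 \<le> a" "a \<le> (1 :: real)"
  obtains D where "measure_pmf.prob (geometric_pmf (1 / 2)) D = a"
proof (cases "a = 1")
  case True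
  with that[of UNIV] show ?thesis by simp
next
  case False
  with assms have a: "0 \<le> a" "a < 1" by auto
  define D where "D = {k. odd \<lfloor>2 ^ (k + 1) * a\<rfloor>}"
  let ?G = "geometric_pmf (1 / 2)"
  have "(\<lambda>m. measure_pmf.prob ?G (D \<inter> {..<m})) \<longlonglongrightarrow> measure_pmf.prob ?G (\<Union>m. D \<inter> {..<m})"
    by (intro measure_pmf.finite_Lim_measure_incseq) (auto simp: incseq_def)
  moreover have "(\<Union>m. D \<inter> {..<m}) = D" by auto
  moreover have "measure_pmf.prob ?G (D \<inter> {..<m}) = \<lfloor>2 ^ m * a\<rfloor> / 2 ^ m" for m
  proof -
    have "measure_pmf.prob ?G (D \<inter> {..<m}) = (\<Sum>k\<in>D \<inter> {..<m}. (1 / 2) ^ (k + 1))"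
      by (subst measure_measure_pmf_finite) auto
    also have "\<dots> = (\<Sum>k<m. if odd \<lfloor>2 ^ (k + 1) * a\<rfloor> then (1 / 2) ^ (k + 1) else 0)"
      by (intro sum.mono_neutral_cong_left) (auto simp: D_def)
    finally show ?thesis using binary_digits_sum[OF a] by simp
  qed
  ultimately have lim: "(\<lambda>m. \<lfloor>2 ^ m * a\<rfloor> / 2 ^ m) \<longlonglongrightarrow> measure_pmf.prob ?G D" by simp
  have "(\<lambda>m. \<lfloor>2 ^ m * a\<rfloor> / 2 ^ m) \<longlonglongrightarrow> a"
  proof (rule tendsto_sandwich)
    show "(\<lambda>m. a - (1 / 2) ^ m) \<longlonglongrightarrow> a" 
      by (rule tendsto_eq_intros LIMSEQ_power_zero refl | simp)+
    show "(\<lambda>m. a) \<longlonglongrightarrow> a" by simp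
    have 1: "a - (1 / 2) ^ m \<le> \<lfloor>2 ^ m * a\<rfloor> / 2 ^ m" for m
    proof -
      have "2 ^ m * a - 1 \<le> \<lfloor>2 ^ m * a\<rfloor>" by linarith
      then have "(2 ^ m * a - 1) / 2 ^ m \<le> \<lfloor>2 ^ m * a\<rfloor> / 2 ^ m" by (intro divide_right_mono) auto
      then show ?thesis by (simp add: field_simps power_one_over)
    qed
    have 2: "\<lfloor>2 ^ m * a\<rfloor> / 2 ^ m \<le> a" for m
    proof -
      have "real_of_int \<lfloor>2 ^ m * a\<rfloor> \<le> 2 ^ m * a" by linarith
      then show ?thesis by (simp add: field_simps)
    qed
    show "\<forall>\<^sub>F m in sequentially. a - (1 / 2) ^ m \<le> \<lfloor>2 ^ m * a\<rfloor> / 2 ^ m" using 1 by simp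
    show "\<forall>\<^sub>F m in sequentially. \<lfloor>2 ^ m * a\<rfloor> / 2 ^ m \<le> a" using 2 by simp
  qed
  with lim have "measure_pmf.prob ?G D = a" by (rule LIMSEQ_unique)
  with that show ?thesis .
qed

lemma two_point_pmf_from_geometric:
  assumes "set_pmf K \<subseteq> {x, y}"
  shows "\<exists>f. map_pmf f (geometric_pmf (1 / 2)) = K"
proof -
  obtain D where D: "measure_pmf.prob (geometric_pmf (1 / 2)) D = pmf K x"
    using geometric_half_prob_surj[OF pmf_nonneg pmf_le_1] .
  define f where "f = (\<lambda>k. if k \<in> D then x else y)"
  let ?Q = "map_pmf f (geometric_pmf (1 / 2))"
  have "?Q = K"
  proof (cases "x = y")
    case True
    then have "f = (\<lambda>_. x)" by (auto simp: f_def)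
    then have "?Q = return_pmf x" by simp
    moreover have "K = return_pmf x" using assms True by (simp add: set_pmf_subset_singleton)
    ultimately show ?thesis by simp
  next
    case False
    have sQ: "set_pmf ?Q \<subseteq> {x, y}" by (auto simp: f_def)
    have tot: "pmf R x + pmf R y = 1" if "set_pmf R \<subseteq> {x, y}" for R
      using sum_pmf_eq_1[OF _ that] False by simp
    have "pmf ?Q x = measure_pmf.prob (geometric_pmf (1 / 2)) (f -` {x})"
      by (simp add: pmf_map)
    also have "f -` {x} = D" using False by (auto simp: f_def)
    finally have x: "pmf ?Q x = pmf K x" using D by simp
    show ?thesis
    proof (rule pmf_eqI)
      fix z
      have "pmf ?Q z = 0 \<and> pmf K z = 0" if "z \<noteq> x" "z \<noteq> y"
        using that sQ assms unfolding pmf_eq_0_set_pmf by blast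
      then show "pmf ?Q z = pmf K z" using x tot[OF sQ] tot[OF assms] by (cases "z = x"; cases "z = y") auto
    qed
  qed
  then show ?thesis by blast
qed

text \<open>The unit interval is cut into consecutive intervals, one for each atom, longest first.\<close>

definition atom_before :: "'a pmf \<Rightarrow> 'a \<Rightarrow> 'a \<Rightarrow> bool" where
  "atom_before p x y \<longleftrightarrow> pmf p x > pmf p y \<or>
     pmf p x = pmf p y \<and> to_nat_on (set_pmf p) x < to_nat_on (set_pmf p) y"

definition atom_left :: "'a pmf \<Rightarrow> 'a \<Rightarrow> real" where
  "atom_left p x = measure_pmf.prob p {y. atom_before p y x}"

definition atom_interval :: "'a pmf \<Rightarrow> 'a \<Rightarrow> real set" where
  "atom_interval p x = {atom_left p x..<atom_left p x + pmf p x}"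

lemma atom_left_nonneg: "atom_left p x \<ge> 0"
  by (simp add: atom_left_def)

lemma not_atom_before_self: "\<not> atom_before p x x"
  by (simp add: atom_before_def)

lemma atom_left_add_eq:
  "atom_left p x + pmf p x = measure_pmf.prob p (insert x {y. atom_before p y x})"
proof -
  have "measure_pmf.prob p ({x} \<union> {y. atom_before p y x})
      = measure_pmf.prob p {x} + measure_pmf.prob p {y. atom_before p y x}"
    by (intro measure_pmf.finite_measure_Union) (auto simp: not_atom_before_self)
  then show ?thesis by (simp add: atom_left_def measure_pmf_single)
qed

lemma atom_left_add_le_1: "atom_left p x + pmf p x \<le> 1"
  by (simp add: atom_left_add_eq)

lemma atom_left_add_le:
  assumes "atom_before p x y"
  shows "atom_left p x + pmf p x \<le> atom_left p y"
  unfolding atom_left_add_eq unfolding atom_left_def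
  by (rule measure_pmf.finite_measure_mono) (use assms in \<open>auto simp: atom_before_def\<close>)

lemma atom_before_total:
  assumes "x \<in> set_pmf p" "y \<in> set_pmf p" "x \<noteq> y"
  shows "atom_before p x y \<or> atom_before p y x"
proof -
  have "to_nat_on (set_pmf p) x \<noteq> to_nat_on (set_pmf p) y"
    using assms by (simp add: inj_on_eq_iff[OF inj_on_to_nat_on[OF countable_set_pmf]])
  then show ?thesis by (auto simp: atom_before_def)
qed

lemma atom_interval_eq_empty: "x \<notin> set_pmf p \<Longrightarrow> atom_interval p x = {}"
  by (simp add: atom_interval_def set_pmf_iff)

lemma disjoint_atom_interval: "disjoint_family (atom_interval p)"
  unfolding disjoint_family_on_def
proof (intro ballI impI)
  fix x y :: 'a assume "x \<noteq> y"
  show "atom_interval p x \<inter> atom_interval p y = {}"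
  proof (cases "x \<in> set_pmf p \<and> y \<in> set_pmf p")
    case True
    with \<open>x \<noteq> y\<close> atom_before_total[of x p y] show ?thesis
      using atom_left_add_le[of p x y] atom_left_add_le[of p y x] by (auto simp: atom_interval_def)
  qed (auto simp: atom_interval_eq_empty)
qed

lemma atom_interval_subset: "atom_interval p x \<subseteq> {0..<1}"
  using atom_left_nonneg[of p x] atom_left_add_le_1[of p x] by (auto simp: atom_interval_def)

lemma emeasure_atom_interval: "emeasure lborel (atom_interval p x) = ennreal (pmf p x)"
  by (simp add: atom_interval_def)

text \<open>The intervals have total length one inside the unit interval, so what they miss is null;
  countable additivity over the support does the rest.\<close>

lemma sum_emeasure_Int_atom_interval:
  assumes A: "A \<in> sets lborel" "A \<subseteq> {0..<1}"
  shows "(\<integral>\<^sup>+x. emeasure lborel (A \<inter> atom_interval p x) \<partial>count_space UNIV) = emeasure lborel A"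
proof -
  let ?S = "set_pmf p" and ?J = "atom_interval p"
  have meas: "?J x \<in> sets lborel" for x by (simp add: atom_interval_def)
  have UN: "(\<integral>\<^sup>+x. emeasure lborel (B \<inter> ?J x) \<partial>count_space UNIV) = emeasure lborel (B \<inter> (\<Union>x\<in>?S. ?J x))"
    if "B \<in> sets lborel" for B
  proof -
    have "(\<integral>\<^sup>+x. emeasure lborel (B \<inter> ?J x) \<partial>count_space UNIV)
        = (\<integral>\<^sup>+x. emeasure lborel (B \<inter> ?J x) \<partial>count_space ?S)"
      by (rule nn_integral_count_space_eq) (auto simp: atom_interval_eq_empty)
    also have "\<dots> = emeasure lborel (\<Union>x\<in>?S. B \<inter> ?J x)"
    proof (rule emeasure_UN_countable[symmetric])
      show "disjoint_family_on (\<lambda>x. B \<inter> ?J x) ?S"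
        using disjoint_atom_interval[of p] by (auto simp: disjoint_family_on_def)
    qed (use that meas in auto)
    finally show ?thesis by (simp only: Int_UN_distrib)
  qed
  have UJ: "(\<Union>x\<in>?S. ?J x) \<in> sets lborel"
    using meas by (intro sets.countable_UN'') auto
  have "emeasure lborel (\<Union>x\<in>?S. ?J x) = (\<integral>\<^sup>+x. ennreal (pmf p x) \<partial>count_space UNIV)"
    using UN[of UNIV] by (simp add: emeasure_atom_interval)
  also have "\<dots> = 1" by (simp add: nn_integral_pmf)
  finally have tot: "emeasure lborel (\<Union>x\<in>?S. ?J x) = 1" .
  have sub: "(\<Union>x\<in>?S. ?J x) \<subseteq> {0..<1}" using atom_interval_subset[of p] by blast
  have "emeasure lborel ({0..<1} - (\<Union>x\<in>?S. ?J x)) = emeasure lborel {0..<1::real} - emeasure lborel (\<Union>x\<in>?S. ?J x)"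
    using UJ sub tot by (intro emeasure_Diff) auto
  also have "\<dots> = 0" by (simp add: tot)
  finally have null: "emeasure lborel ({0..<1} - (\<Union>x\<in>?S. ?J x)) = 0" .
  have "emeasure lborel (A - (\<Union>x\<in>?S. ?J x)) = 0"
  proof -
    have "emeasure lborel (A - (\<Union>x\<in>?S. ?J x)) \<le> emeasure lborel ({0..<1} - (\<Union>x\<in>?S. ?J x))"
      using A UJ by (intro emeasure_mono) auto
    with null show ?thesis by simp
  qed
  then have "emeasure lborel A = emeasure lborel (A \<inter> (\<Union>x\<in>?S. ?J x))"
    using A UJ by (subst emeasure_Un_null_set[symmetric, of _ _ "A - (\<Union>x\<in>?S. ?J x)"])
      (auto intro!: arg_cong[where f="emeasure lborel"] simp: null_sets_def)
  with UN[OF A(1)] show ?thesis by simp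
qed

text \<open>Were \<open>pmf C j\<close> larger, the stack of \<open>C\<close> up to and including
  \<open>j\<close> would be no higher than the mass of its atoms heavier than
  \<open>pmf P x\<close>. By \<open>dom\<close> this is at most the corresponding mass for
  \<open>P\<close>, all of which lies before \<open>x\<close>, so the intervals could not
  meet.\<close>

lemma atom_mass_le_of_overlap:
  assumes dom: "\<And>l. l \<ge> 0 \<Longrightarrow> measure_pmf.prob C {j. pmf C j > l} \<le> measure_pmf.prob P {x. pmf P x > l}"
    and u: "u \<in> atom_interval C j" "u \<in> atom_interval P x"
  shows "pmf C j \<le> pmf P x"
proof (rule ccontr)
  assume "\<not> ?thesis"
  then have less: "pmf P x < pmf C j" by simp
  have "u < atom_left C j + pmf C j" using u by (simp add: atom_interval_def)
  also have "\<dots> \<le> measure_pmf.prob C {i. pmf C i > pmf P x}"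
    unfolding atom_left_add_eq
    by (rule measure_pmf.finite_measure_mono) (use less in \<open>auto simp: atom_before_def\<close>)
  also have "\<dots> \<le> measure_pmf.prob P {y. pmf P y > pmf P x}" by (rule dom) simp
  also have "\<dots> \<le> atom_left P x" unfolding atom_left_def
    by (rule measure_pmf.finite_measure_mono) (auto simp: atom_before_def)
  also have "\<dots> \<le> u" using u by (simp add: atom_interval_def)
  finally show False by simp
qed

text \<open>Of three atoms meeting one cell, the middle one would be strictly shorter than the cell,
  against \<open>atom_mass_le_of_overlap\<close>.\<close>

lemma overlap_two_atoms:
  assumes dom: "\<And>l. l \<ge> 0 \<Longrightarrow> measure_pmf.prob C {j. pmf C j > l} \<le> measure_pmf.prob P {x. pmf P x > l}"
  obtains x y where "{z. atom_interval C j \<inter> atom_interval P z \<noteq> {}} \<subseteq> {x, y}"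
proof -
  let ?T = "{z. atom_interval C j \<inter> atom_interval P z \<noteq> {}}"
  have TS: "z \<in> set_pmf P" if "z \<in> ?T" for z using that by (cases "z \<in> set_pmf P") (auto simp: atom_interval_eq_empty)
  have no3: False if x: "x \<in> ?T" "y \<in> ?T" "z \<in> ?T" "atom_before P x y" "atom_before P y z" for x y z
  proof -
    obtain u v w where uvw: "u \<in> atom_interval C j" "u \<in> atom_interval P x"
      "v \<in> atom_interval C j" "v \<in> atom_interval P y" "w \<in> atom_interval C j" "w \<in> atom_interval P z"
      using x by blast
    have "pmf C j \<le> pmf P y" by (rule atom_mass_le_of_overlap[OF dom uvw(3,4)])
    moreover have "u < atom_left P y" "atom_left P y + pmf P y \<le> w"
      using uvw atom_left_add_le[OF x(4)] atom_left_add_le[OF x(5)] by (auto simp: atom_interval_def)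
    ultimately show False using uvw(1,5) by (auto simp: atom_interval_def)
  qed
  have "\<exists>x y. ?T \<subseteq> {x, y}"
  proof (rule ccontr)
    assume H: "\<nexists>x y. ?T \<subseteq> {x, y}"
    obtain x where x: "x \<in> ?T" using H by blast
    obtain y where y: "y \<in> ?T" "y \<noteq> x" using H[simplified not_ex, rule_format, of x x] by blast
    obtain z where z: "z \<in> ?T" "z \<noteq> x" "z \<noteq> y" using H[simplified not_ex, rule_format, of x y] by blast
    from atom_before_total[OF TS[OF x] TS[OF y(1)]] atom_before_total[OF TS[OF x] TS[OF z(1)]]
      atom_before_total[OF TS[OF y(1)] TS[OF z(1)]] x y z show False
      using no3 by metis
  qed
  with that show ?thesis by blast
qed

text \<open>If the atoms of \<open>C\<close> are stochastically smaller than those of \<open>P\<close>, then an interval of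
  \<open>C\<close> never contains two division points of \<open>P\<close>, so a coin flip decides the value.\<close>

lemma pmf_from_finer_pmf_and_geometric:
  fixes C :: "'c pmf" and P :: "'b pmf"
  assumes dom: "\<And>l. l \<ge> 0 \<Longrightarrow> measure_pmf.prob C {j. pmf C j > l} \<le> measure_pmf.prob P {x. pmf P x > l}"
  shows "\<exists>f. map_pmf f (pair_pmf C (geometric_pmf (1 / 2))) = P"
proof -
  \<comment> \<open>\<open>m\<close> is the joint law of the cell and the atom hit by one uniform
    point. Its margins are \<open>C\<close> and \<open>P\<close>, and \<open>K j\<close> below is
    the conditional law of the atom given cell \<open>j\<close>.\<close>
  define m where "m j x = measure lborel (atom_interval C j \<inter> atom_interval P x)" for j x
  have em: "emeasure lborel (atom_interval C j \<inter> atom_interval P x) = ennreal (m j x)" for j x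
  proof -
    have "emeasure lborel (atom_interval C j \<inter> atom_interval P x) \<le> emeasure lborel (atom_interval C j)"
      by (intro emeasure_mono) (auto simp: atom_interval_def)
    also have "\<dots> < \<infinity>" by (simp add: emeasure_atom_interval)
    finally show ?thesis unfolding m_def by (intro emeasure_eq_ennreal_measure) auto
  qed
  have row: "(\<integral>\<^sup>+x. ennreal (m j x) \<partial>count_space UNIV) = ennreal (pmf C j)" for j
    using sum_emeasure_Int_atom_interval[of "atom_interval C j" P] atom_interval_subset[of C j]
    by (simp add: em emeasure_atom_interval) (simp add: atom_interval_def)
  have col: "(\<integral>\<^sup>+j. ennreal (m j x) \<partial>count_space UNIV) = ennreal (pmf P x)" for x
  proof -
    have "(\<integral>\<^sup>+j. emeasure lborel (atom_interval P x \<inter> atom_interval C j) \<partial>count_space UNIV) = ennreal (pmf P x)"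
      using sum_emeasure_Int_atom_interval[of "atom_interval P x" C] atom_interval_subset[of P x]
      by (simp add: emeasure_atom_interval) (simp add: atom_interval_def)
    then show ?thesis by (simp only: Int_commute[of "atom_interval P x"] em)
  qed
  have m_nonneg: "m j x \<ge> 0" for j x by (simp add: m_def)
  have "\<exists>K. \<forall>x. pmf K x = m j x / pmf C j" if "j \<in> set_pmf C" for j
  proof (intro exI allI)
    fix x
    have pos: "pmf C j > 0" using that by (simp add: pmf_positive_iff)
    have "(\<integral>\<^sup>+x. ennreal (m j x / pmf C j) \<partial>count_space UNIV)
        = (\<integral>\<^sup>+x. ennreal (m j x) \<partial>count_space UNIV) / ennreal (pmf C j)"
      using pos by (subst nn_integral_divide[symmetric]) (auto simp: divide_ennreal m_nonneg)
    also have "\<dots> = 1" using pos by (simp add: row divide_ennreal)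
    finally show "pmf (embed_pmf (\<lambda>x. m j x / pmf C j)) x = m j x / pmf C j"
      by (intro pmf_embed_pmf) (simp_all add: m_nonneg divide_nonneg_nonneg pmf_nonneg)
  qed
  then obtain K where K: "\<And>j x. j \<in> set_pmf C \<Longrightarrow> pmf (K j) x = m j x / pmf C j" by metis
  have "\<exists>f. map_pmf f (geometric_pmf (1 / 2)) = K j" if "j \<in> set_pmf C" for j
  proof -
    obtain x y where "{z. atom_interval C j \<inter> atom_interval P z \<noteq> {}} \<subseteq> {x, y}"
      by (rule overlap_two_atoms[OF dom])
    moreover have "atom_interval C j \<inter> atom_interval P z \<noteq> {}" if "z \<in> set_pmf (K j)" for z
    proof
      assume "atom_interval C j \<inter> atom_interval P z = {}"
      then have "m j z = 0" by (simp add: m_def)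
      with K[OF \<open>j \<in> set_pmf C\<close>] \<open>z \<in> set_pmf (K j)\<close> show False by (simp add: set_pmf_iff)
    qed
    ultimately have "set_pmf (K j) \<subseteq> {x, y}" by blast
    then show ?thesis by (rule two_point_pmf_from_geometric)
  qed
  then obtain f where f: "\<And>j. j \<in> set_pmf C \<Longrightarrow> map_pmf (f j) (geometric_pmf (1 / 2)) = K j" by metis
  have "map_pmf (\<lambda>(j, k). f j k) (pair_pmf C (geometric_pmf (1 / 2))) = bind_pmf C (\<lambda>j. map_pmf (f j) (geometric_pmf (1 / 2)))"
    by (simp add: pair_pmf_def map_bind_pmf map_pmf_def bind_assoc_pmf bind_return_pmf)
  also have "\<dots> = bind_pmf C K" by (intro bind_pmf_cong refl f)
  also have "\<dots> = P"
  proof (rule pmf_eqI)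
    fix x
    have "ennreal (pmf (bind_pmf C K) x) = (\<integral>\<^sup>+j. ennreal (pmf C j) * ennreal (pmf (K j) x) \<partial>count_space UNIV)"
      by (simp add: ennreal_pmf_bind nn_integral_measure_pmf)
    also have "\<dots> = (\<integral>\<^sup>+j. ennreal (m j x) \<partial>count_space UNIV)"
    proof (intro nn_integral_cong)
      fix j
      show "ennreal (pmf C j) * ennreal (pmf (K j) x) = ennreal (m j x)"
      proof (cases "j \<in> set_pmf C")
        case True
        then have "pmf C j > 0" by (simp add: pmf_positive_iff)
        then show ?thesis using True by (simp add: K m_nonneg flip: ennreal_mult')
      next
        case False
        then show ?thesis by (simp add: m_def atom_interval_eq_empty set_pmf_iff)
      qed
    qed
    finally show "pmf (bind_pmf C K) x = pmf P x" by (simp add: col)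
  qed
  finally show ?thesis by blast
qed

subsection \<open>A root of the geometric law under maximum\<close>

lemma pmf_from_tails:
  fixes r :: "nat \<Rightarrow> real"
  assumes "r 0 = 1" "decseq r" "r \<longlonglongrightarrow> 0"
  shows "pmf (embed_pmf (\<lambda>k. r k - r (Suc k))) k = r k - r (Suc k)"
proof (rule pmf_embed_pmf)
  show nn: "0 \<le> r k - r (Suc k)" for k using assms(2) by (simp add: decseq_Suc_iff)
  have "(\<lambda>k. r k - r (Suc k)) sums (r 0 - 0)" by (rule telescope_sums'[OF assms(3)])
  then show "(\<integral>\<^sup>+k. ennreal (r k - r (Suc k)) \<partial>count_space UNIV) = 1"
    using assms(1) nn sums_unique sums_summable
    by (subst nn_integral_count_space_nat, subst suminf_ennreal2) force+
qed

lemma pmf_nat_eqI_atMost: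
  fixes p q :: "nat pmf"
  assumes "\<And>k. measure_pmf.prob p {..k} = measure_pmf.prob q {..k}"
  shows "p = q"
proof (rule pmf_eqI)
  have "pmf p k = measure_pmf.prob p {..k} - (if k = 0 then 0 else measure_pmf.prob p {..k - 1})" for p :: "nat pmf" and k
  proof (cases k)
    case 0 
    then show ?thesis by (simp add: measure_pmf_single)
  next
    case (Suc l)
    then show ?thesis by (simp add: measure_measure_pmf_finite)
  qed
  then show "pmf p k = pmf q k" for k using assms by metis
qed

lemma geometric_half_prob_atMost:
  "measure_pmf.prob (geometric_pmf (1 / 2)) {..k} = 1 - (1 / 2) ^ (k + 1)"
  by (induction k) (simp_all add: measure_measure_pmf_finite)

text \<open>The tails of a law whose maximum over \<open>n\<close> independent copies is \<open>geometric_pmf (1 / 2)\<close>.\<close>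

definition root_tail :: "nat \<Rightarrow> nat \<Rightarrow> real" where
  "root_tail n k = 1 - (1 - (1 / 2) ^ k) powr (1 / n)"

text \<open>Indexing: \<open>root_tail n k\<close> is the probability of a value at least
  \<open>k\<close>, not above \<open>k\<close>.\<close>

definition root_geometric_pmf :: "nat \<Rightarrow> nat pmf" where
  "root_geometric_pmf n = embed_pmf (\<lambda>k. root_tail n k - root_tail n (Suc k))"

context
  fixes n :: nat
  assumes n: "n \<ge> 1"
begin

lemma root_tail_0: "root_tail n 0 = 1"
  by (simp add: root_tail_def)

lemma root_tail_1: "root_tail n 1 = 1 - 2 powr (- 1 / n)"
  by (simp add: root_tail_def powr_minus_divide powr_divide)

lemma root_tail_nonneg: "root_tail n k \<ge> 0"
proof -
  have "(1 - (1 / 2 :: real) ^ k) powr (1 / n) \<le> 1 powr (1 / n)"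
    by (rule powr_mono2) (auto simp: power_le_one)
  then show ?thesis by (simp add: root_tail_def)
qed

lemma decseq_root_tail: "decseq (root_tail n)"
  unfolding decseq_def root_tail_def
  by (auto intro!: powr_mono2 power_decreasing simp: power_le_one)

lemma root_tail_tendsto: "root_tail n \<longlonglongrightarrow> 0"
proof -
  have "(\<lambda>k. 1 - (1 - (1 / 2 :: real) ^ k) powr (1 / n)) \<longlonglongrightarrow> 1 - (1 - 0) powr (1 / n)"
    by (intro tendsto_intros LIMSEQ_power_zero) auto
  then show ?thesis by (simp add: root_tail_def[abs_def])
qed

lemma pmf_root_geometric: "pmf (root_geometric_pmf n) k = root_tail n k - root_tail n (Suc k)"
  unfolding root_geometric_pmf_def
  by (rule pmf_from_tails[OF root_tail_0 decseq_root_tail root_tail_tendsto])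

lemma root_geometric_prob_atMost:
  "measure_pmf.prob (root_geometric_pmf n) {..k} = (1 - (1 / 2) ^ (k + 1)) powr (1 / n)"
proof -
  have "measure_pmf.prob (root_geometric_pmf n) {..k} = (\<Sum>i<Suc k. root_tail n i - root_tail n (Suc i))"
    by (simp add: measure_measure_pmf_finite pmf_root_geometric lessThan_Suc_atMost)
  also have "\<dots> = root_tail n 0 - root_tail n (Suc k)" by (rule sum_lessThan_telescope')
  finally show ?thesis by (simp add: root_tail_0) (simp add: root_tail_def)
qed

text \<open>The distribution function of the maximum is the \<open>n\<close>-th power of that of one
  copy, which is the \<open>n\<close>-th root of the geometric one.\<close>

lemma Max_root_geometric:
  "map_pmf (\<lambda>g. Max (g ` {1..n})) (Pi_pmf {1..n} d (\<lambda>_. root_geometric_pmf n)) = geometric_pmf (1 / 2)"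
proof (rule pmf_nat_eqI_atMost)
  fix k
  have ne: "{1..n} \<noteq> {}" using n by simp
  have "measure_pmf.prob (map_pmf (\<lambda>g. Max (g ` {1..n})) (Pi_pmf {1..n} d (\<lambda>_. root_geometric_pmf n))) {..k}
    = measure_pmf.prob (Pi_pmf {1..n} d (\<lambda>_. root_geometric_pmf n)) (Pi {1..n} (\<lambda>_. {..k}))"
    using ne by (simp add: Pi_def) (auto intro!: arg_cong2[where f=measure])
  also have "\<dots> = (\<Prod>i\<in>{1..n}. measure_pmf.prob (root_geometric_pmf n) {..k})"
    by (rule measure_Pi_pmf_Pi) simp
  also have "\<dots> = ((1 - (1 / 2) ^ (k + 1)) powr (1 / n)) ^ n"
    by (simp add: root_geometric_prob_atMost)
  also have "\<dots> = ((1 - (1 / 2) ^ (k + 1)) powr (1 / n)) powr n"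
  proof -
    have "(1 / 2 :: real) ^ (k + 1) < 1"
      using power_Suc_less_one[of "1 / 2 :: real" k] by simp
    then show ?thesis by (subst powr_realpow) auto
  qed
  also have "\<dots> = 1 - (1 / 2) ^ (k + 1)"
  proof -
    have "(1 / 2 :: real) ^ (k + 1) \<le> 1" by (rule power_le_one) simp_all
    then show ?thesis using n by (simp add: powr_powr)
  qed
  finally show "measure_pmf.prob (map_pmf (\<lambda>g. Max (g ` {1..n})) (Pi_pmf {1..n} d (\<lambda>_. root_geometric_pmf n))) {..k}
      = measure_pmf.prob (geometric_pmf (1 / 2)) {..k}"
    by (simp add: geometric_half_prob_atMost)
qed


text \<open>In terms of \<open>u = (1 - 2\<^sup>-\<^sup>k) powr (1 / n)\<close> this is the convexity \<open>((1 + u) / 2) ^ n \<le> (1 + u ^ n) / 2\<close>.\<close>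

lemma root_tail_Suc_le: "root_tail n (Suc k) \<le> root_tail n k / 2"
proof -
  define s where "s = (1 / 2 :: real) ^ k"
  define u where "u = (1 - s) powr (1 / n)"
  have s: "0 < s" "s \<le> 1" by (auto simp: s_def power_le_one)
  have un: "u ^ n = 1 - s"
  proof (cases "s = 1")
    case True
    then show ?thesis using n by (simp add: u_def)
  next
    case False
    with s have "u ^ n = u powr n" by (simp add: u_def powr_realpow)
    then show ?thesis using s n by (simp add: u_def powr_powr)
  qed
  have u: "0 \<le> u" by (simp add: u_def)
  have "((1 / 2) * 1 + (1 / 2) * u) ^ n \<le> (1 / 2) * 1 ^ n + (1 / 2) * u ^ n"
  proof -
    have "convex_on {0..} (\<lambda>x :: real. x ^ n)"
      using convex_power_even[of n] convex_power_odd[of n] convex_on_subset[of UNIV _ "{0..}"]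
      by (cases "even n") auto
    from convex_onD[OF this, of "1 / 2" 1 u] u show ?thesis by simp
  qed
  moreover have "(1 / 2) * 1 + (1 / 2) * u = (1 + u) / 2" by simp
  moreover have "(1 / 2) * 1 ^ n + (1 / 2) * (1 - s) = 1 - s / 2" by (simp add: diff_divide_distrib)
  ultimately have "((1 + u) / 2) ^ n \<le> 1 - s / 2" by (simp only: un)
  then have "(((1 + u) / 2) ^ n) powr (1 / n) \<le> (1 - s / 2) powr (1 / n)"
    using u by (intro powr_mono2) auto
  moreover have "(((1 + u) / 2) ^ n) powr (1 / n) = (1 + u) / 2"
    using u n by (simp add: powr_realpow[symmetric] powr_powr)
  ultimately have "(1 + u) / 2 \<le> (1 - s / 2) powr (1 / n)" by simp
  then show ?thesis by (simp add: root_tail_def u_def s_def field_simps)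
qed

text \<open>Halving makes each tail at most twice its drop to the next one, and the drops
  telescope.\<close>

lemma sum_root_tail_le:
  assumes "j \<le> m"
  shows "(\<Sum>k=j..<m. root_tail n k) \<le> 2 * root_tail n j - 2 * root_tail n m"
  using assms
proof (induction m rule: dec_induct)
  case (step m)
  then show ?case using root_tail_Suc_le[of m] by simp
qed simp

text \<open>Gibbs' inequality against the law that agrees at \<open>0\<close> and has a geometric tail.\<close>

lemma root_geometric_partial_entropy:
  fixes m
  defines "b \<equiv> root_tail n 1"
  shows "(\<Sum>k<Suc m. - pmf (root_geometric_pmf n) k * log 2 (pmf (root_geometric_pmf n) k))
     \<le> - (1 - b) * log 2 (1 - b) - (b - root_tail n (Suc m)) * log 2 b
        + ((\<Sum>k=1..<Suc m. root_tail n k) - m * root_tail n (Suc m))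
        + log 2 (exp 1) * (root_tail n (Suc m) - b / 2 ^ m)"
proof (induction m)
  case 0
  show ?case by (simp add: pmf_root_geometric root_tail_0 b_def)
next
  case (Suc m)
  let ?r = "root_tail n" and ?g = "pmf (root_geometric_pmf n) (Suc m)"
  have "2 powr (- 1 / n) < 2 powr 0" using n by (intro powr_less_mono) auto
  then have b: "0 < b" unfolding b_def root_tail_1 by simp
  \<comment> \<open>The comparison mass at \<open>Suc m\<close> is \<open>b / 2 ^ Suc m\<close>,
    with information \<open>Suc m - log 2 b\<close>; the last term is the tangent-line
    correction.\<close>
  have "- ?g * log 2 ?g \<le> ?g * (Suc m - log 2 b) + log 2 (exp 1) * (b / 2 ^ Suc m - ?g)"
  proof (cases "?g = 0")
    case True
    have "0 \<le> log 2 (exp 1) * (b / 2 ^ Suc m)"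
      using b by (intro mult_nonneg_nonneg) auto
    with True show ?thesis by simp
  next
    case False
    then have g: "?g > 0" using pmf_nonneg[of _ "Suc m"] by (simp add: less_le)
    have "log 2 (b / 2 ^ Suc m / ?g) \<le> (b / 2 ^ Suc m / ?g - 1) * log 2 (exp 1)"
      using b g by (intro log2_le_sub_one) simp
    moreover have "log 2 (b / 2 ^ Suc m / ?g) = log 2 b - Suc m - log 2 ?g"
      using b g by (simp add: log_divide log_mult log_nat_power del: power_Suc)
    ultimately have "?g * (log 2 b - Suc m - log 2 ?g) \<le> ?g * ((b / 2 ^ Suc m / ?g - 1) * log 2 (exp 1))"
      using g by (intro mult_left_mono) auto
    also have "\<dots> = log 2 (exp 1) * (b / 2 ^ Suc m - ?g)"
    proof -
      have "?g * (b / 2 ^ Suc m / ?g - 1) = b / 2 ^ Suc m - ?g" using g by (simp add: algebra_simps)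
      then show ?thesis by (metis mult.assoc mult.commute)
    qed
    finally show ?thesis by (simp only: algebra_simps)
  qed
  \<comment> \<open>The increment of the claimed bound. Tail sums enter through summation by parts:
    the partial mean up to \<open>m\<close> is the sum of the tails from \<open>1\<close> to
    \<open>m\<close> minus \<open>m * root_tail n (Suc m)\<close>.\<close>
  moreover have "(- (1 - b) * log 2 (1 - b) - (b - ?r (Suc (Suc m))) * log 2 b
        + ((\<Sum>k=1..<Suc (Suc m). ?r k) - Suc m * ?r (Suc (Suc m)))
        + c * (?r (Suc (Suc m)) - b / 2 ^ Suc m))
      - (- (1 - b) * log 2 (1 - b) - (b - ?r (Suc m)) * log 2 b
        + ((\<Sum>k=1..<Suc m. ?r k) - m * ?r (Suc m)) + c * (?r (Suc m) - b / 2 ^ m))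
      = ?g * (Suc m - log 2 b) + c * (b / 2 ^ Suc m - ?g)" for c
  proof -
    have id: "(A - (b - r2) * L + ((T + r1) - (M + 1) * r2) + c * (r2 - B))
        - (A - (b - r1) * L + (T - M * r1) + c * (r1 - 2 * B))
        = (r1 - r2) * ((M + 1) - L) + c * (B - (r1 - r2))" for A L T r1 r2 M B :: real
      by (simp add: algebra_simps)
    have sums: "(\<Sum>k=1..<Suc (Suc m). ?r k) = (\<Sum>k=1..<Suc m. ?r k) + ?r (Suc m)" by simp
    have pow: "b / 2 ^ m = 2 * (b / 2 ^ Suc m)" by simp
    have suc: "real (Suc m) = real m + 1" by simp
    show ?thesis unfolding pmf_root_geometric sums pow suc by (rule id)
  qed
  ultimately show ?case using Suc.IH unfolding sum.lessThan_Suc[of _ "Suc m"]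
    by (smt (verit))
qed

text \<open>The sum of the tails is the mean, so \<open>S\<close> bounds the mean. The comparison
  information \<open>k - log 2 b\<close> averages to the binary entropy plus the mean, once the atom
  at \<open>0\<close> is included; the remaining correction is a multiple of a vanishing
  tail.\<close>

lemma root_geometric_entropy_le:
  assumes S: "\<And>m. (\<Sum>k=1..<m. root_tail n k) \<le> S"
  shows "pmf_entropy (root_geometric_pmf n) \<le> ennreal (binary_entropy (2 powr (- 1 / n)) + S)"
proof (rule pmf_entropy_nat_le)
  define b where "b = root_tail n 1"
  let ?B = "binary_entropy (2 powr (- 1 / n)) + S"
  have bin: "binary_entropy (2 powr (- 1 / n)) = - (1 - b) * log 2 (1 - b) - b * log 2 b"
    unfolding b_def root_tail_1 by (simp add: binary_entropy_def)
  have "2 powr (- 1 / n) < 2 powr 0" using n by (intro powr_less_mono) auto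
  then have b: "0 < b" "b < 1" unfolding b_def root_tail_1 by simp_all
  have "(\<lambda>m. ?B + log 2 (exp 1) * root_tail n m) \<longlonglongrightarrow> ?B + log 2 (exp 1) * 0"
    by (intro tendsto_intros root_tail_tendsto)
  then show "(\<lambda>m. ?B + log 2 (exp 1) * root_tail n m) \<longlonglongrightarrow> ?B" by simp
  fix m
  show "(\<Sum>k<m. - pmf (root_geometric_pmf n) k * log 2 (pmf (root_geometric_pmf n) k))
      \<le> ?B + log 2 (exp 1) * root_tail n m"
  proof (cases m)
    case 0
    have "2 powr (- 1 / n) = 1 - b" unfolding b_def root_tail_1 by simp
    then have "0 \<le> ?B" using S[of 0] b binary_entropy_nonneg[of "1 - b"] by simp
    moreover have "0 \<le> log 2 (exp 1) * root_tail n 0" by (simp add: root_tail_0)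
    ultimately show ?thesis using 0 by simp
  next
    case (Suc l)
    have "0 \<le> - (root_tail n (Suc l) * log 2 b)" using b root_tail_nonneg[of "Suc l"]
      by (simp add: mult_nonneg_nonpos)
    moreover have "0 \<le> l * root_tail n (Suc l)" by (simp add: root_tail_nonneg)
    moreover have "0 \<le> log 2 (exp 1) * (b / 2 ^ l)" using b by (intro mult_nonneg_nonneg) auto
    ultimately show ?thesis
      using root_geometric_partial_entropy[of l, folded b_def] S[of "Suc l"]
      unfolding Suc bin right_diff_distrib left_diff_distrib by linarith
  qed
qed

lemma root_geometric_entropy_le_doubled:
  "pmf_entropy (root_geometric_pmf n)
     \<le> ennreal (binary_entropy (2 powr (- 1 / n)) + 2 * (1 - 2 powr (- 1 / n)))"
proof (rule root_geometric_entropy_le)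
  fix m
  show "(\<Sum>k=1..<m. root_tail n k) \<le> 2 * (1 - 2 powr (- 1 / n))"
    using sum_root_tail_le[of 1 m] root_tail_nonneg[of m] root_tail_nonneg[of 1]
    unfolding root_tail_1[symmetric] by (cases "1 \<le> m") auto
qed

end

section \<open>Numerical bounds for the root of the geometric law\<close>

lemma binary_entropy_inverse_sqrt_2: "binary_entropy (2 powr (- 1 / 2)) \<le> 0.873"
proof -
  define x :: real where "x = 2 powr (- 1 / 2)"
  have x: "x = 1 / sqrt 2" by (simp add: x_def powr_minus_divide powr_half_sqrt)
  then have x2: "x\<^sup>2 = 1 / 2" "x > 0" by (simp_all add: power_divide)
  have lo: "x \<ge> 0.7071" by (rule power2_le_imp_le) (use x2 in \<open>auto simp: power2_eq_square\<close>)
  have hi: "x \<le> 0.7072" by (rule power2_le_imp_le) (use x2 in \<open>auto simp: power2_eq_square\<close>)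
  have lx: "log 2 x = - 1 / 2" by (simp add: x_def)
  \<comment> \<open>As \<open>(1 - x) * (1 + x) = 1 / 2\<close>, only \<open>log 2 (1 + x)\<close>
    needs a bound. The exponents 22 and 17 below give \<open>17 / 22\<close>, slightly above
    \<open>log 2 1.7072\<close>.\<close>
  have l1: "- log 2 (1 - x) = 1 + log 2 (1 + x)"
  proof -
    have "(1 - x) * (1 + x) = 1 / 2" using x2 by (simp add: algebra_simps power2_eq_square)
    then have "log 2 ((1 - x) * (1 + x)) = log 2 (1 / 2)" by (simp only:)
    also have "\<dots> = - 1" by (simp add: log_divide)
    finally have "log 2 ((1 - x) * (1 + x)) = - 1" .
    moreover have "log 2 ((1 - x) * (1 + x)) = log 2 (1 - x) + log 2 (1 + x)"
      using lo hi by (intro log_mult_pos) auto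
    ultimately show ?thesis by simp
  qed
  have "(1 + x) ^ 22 \<le> 1.7072 ^ 22" using lo hi by (intro power_mono) auto
  also have "\<dots> \<le> 2 ^ 17" by (simp add: power_divide)
  finally have "log 2 ((1 + x) ^ 22) \<le> log 2 (2 ^ 17)" using lo by (subst log_le_cancel_iff) auto
  then have "22 * log 2 (1 + x) \<le> 17"
    using lo log_nat_power[of "1 + x" 2 22] log_nat_power[of 2 2 17] by simp
  then have "(1 - x) * (1 + log 2 (1 + x)) \<le> (1 - x) * (1 + 17 / 22)"
    using hi by (intro mult_left_mono) auto
  then have "(1 - x) * - log 2 (1 - x) \<le> (1 - x) * (1 + 17 / 22)" using l1 by simp
  then have "- x * log 2 x - (1 - x) * log 2 (1 - x) \<le> 0.873"
    using lo hi by (simp add: lx)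
  then show ?thesis unfolding x_def[symmetric] binary_entropy_def .
qed

text \<open>For \<open>n = 2\<close> the doubling bound gives about 1.46, so the first two tails are
  evaluated and doubling starts at the third. For \<open>n \<ge> 3\<close> the number
  \<open>2 powr (- 1 / n)\<close> is at least \<open>3 / 4\<close>, and doubling gives at most
  \<open>7 / 8 + 1 / 2\<close>.\<close>

lemma root_geometric_entropy_le_const:
  assumes "n \<ge> 2"
  shows "pmf_entropy (root_geometric_pmf n) \<le> ennreal 1.43"
proof (cases "n = 2")
  case True
  have rt: "root_tail 2 1 \<le> 0.2929" "root_tail 2 2 \<le> 0.134" "root_tail 2 3 \<le> 0.0646"
  proof -
    have "sqrt (1 / 2) \<ge> 0.7071" "sqrt (3 / 4) \<ge> 0.866" "sqrt (7 / 8) \<ge> 0.9354"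
      by (rule real_le_rsqrt, simp add: power2_eq_square)+
    then show "root_tail 2 1 \<le> 0.2929" "root_tail 2 2 \<le> 0.134" "root_tail 2 3 \<le> 0.0646"
      unfolding root_tail_def by (simp_all add: powr_half_sqrt power2_eq_square power3_eq_cube)
  qed
  have "pmf_entropy (root_geometric_pmf 2) \<le> ennreal (binary_entropy (2 powr (- 1 / real 2)) + 0.5561)"
  proof (rule root_geometric_entropy_le)
    fix m
    have *: "(\<Sum>k=1..<m. root_tail 2 k) \<le> 0.5561" if "m \<ge> 3" for m
    proof -
      have "(\<Sum>k=1..<m. root_tail 2 k) = (\<Sum>k=1..<3. root_tail 2 k) + (\<Sum>k=3..<m. root_tail 2 k)"
        using that by (simp add: sum.atLeastLessThan_concat)
      also have "(\<Sum>k=1..<3. root_tail 2 k) = root_tail 2 1 + root_tail 2 2" by (simp add: numeral_3_eq_3 numeral_2_eq_2)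
      finally show ?thesis using sum_root_tail_le[of 2 3 m] that root_tail_nonneg[of 2 m] rt by simp
    qed
    have "(\<Sum>k=1..<m. root_tail 2 k) \<le> (\<Sum>k=1..<max m 3. root_tail 2 k)"
      by (intro sum_mono2) (auto simp: root_tail_nonneg)
    also have "\<dots> \<le> 0.5561" by (rule *) simp
    finally show "(\<Sum>k=1..<m. root_tail 2 k) \<le> 0.5561" .
  qed simp
  also have "\<dots> \<le> ennreal 1.43"
    using binary_entropy_inverse_sqrt_2 by (intro ennreal_leI) simp
  finally show ?thesis using True by simp
next
  case False
  with assms have n: "n \<ge> 3" by simp
  let ?x = "2 powr (- 1 / real n)"
  have "(3 / 4 :: real) = ((3 / 4) powr 3) powr (1 / 3)" by (subst powr_powr) simp
  also have "\<dots> \<le> (1 / 2) powr (1 / 3)" by (intro powr_mono2) (auto simp: powr_numeral power3_eq_cube)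
  also have "\<dots> \<le> (1 / 2) powr (1 / n)" using n by (intro powr_mono') (auto simp: field_simps)
  also have "\<dots> = ?x" by (simp add: powr_minus_divide powr_divide)
  finally have x: "3 / 4 \<le> ?x" .
  have x1: "?x \<le> 1" using powr_mono[of "- 1 / real n" 0 2] by simp
  have "log 2 3 \<ge> 3 / 2"
  proof -
    have "log 2 8 = 3" "log 2 9 = 2 * log 2 3"
      using log_nat_power[of 2 2 3] log_nat_power[of 3 2 2] by simp_all
    moreover have "log 2 8 \<le> log 2 (9 :: real)" by simp
    ultimately show ?thesis by linarith
  qed
  have "log 2 4 = 2" using log_nat_power[of 2 2 2] by simp
  then have "log 2 (1 / 4) = - 2" "log 2 (3 / 4) = log 2 3 - 2" by (simp_all add: log_divide)
  moreover have "binary_entropy (1 / 4) = - (1 / 4) * log 2 (1 / 4) - (3 / 4) * log 2 (3 / 4)"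
    by (simp add: binary_entropy_def)
  ultimately have "binary_entropy (1 / 4) \<le> 7 / 8" using \<open>log 2 3 \<ge> 3 / 2\<close> by linarith
  moreover have "binary_entropy (1 - ?x) \<le> binary_entropy (1 / 4)"
    using x x1 by (intro binary_entropy_mono) auto
  ultimately have "binary_entropy ?x + 2 * (1 - ?x) \<le> 1.43"
    using x by (simp add: binary_entropy_sym)
  then show ?thesis
    using root_geometric_entropy_le_doubled[of n] n ennreal_leI order_trans by fastforce
qed

subsection \<open>Greedy atoms and mass quantiles\<close>

text \<open>Atoms laid end to end from \<open>0\<close>, each as long as possible subject to lying below the graph of \<open>D\<close>.\<close>

definition greedy_atoms :: "(real \<Rightarrow> real) \<Rightarrow> (nat \<Rightarrow> real) \<Rightarrow> bool" where
  "greedy_atoms D w \<longleftrightarrow> (\<forall>k. 0 \<le> w k) \<and> decseq w \<and> w sums 1 \<and>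
     (\<forall>k u. 0 \<le> u \<and> u < sum w {..k} \<longrightarrow> w k \<le> D u) \<and>
     (\<forall>k u. sum w {..k} < u \<longrightarrow> D u \<le> w k)"

text \<open>The next length is the supremum \<open>g s\<close> of the lengths \<open>A s\<close>
  admissible at the current position \<open>s\<close>. Maximality keeps \<open>D\<close> below it
  further on, and positivity of \<open>D\<close> before \<open>1\<close> forces the atoms to fill
  the interval.\<close>

lemma greedy_atoms_exist:
  fixes D :: "real \<Rightarrow> real"
  assumes mono: "\<And>u v. 0 \<le> u \<Longrightarrow> u \<le> v \<Longrightarrow> D v \<le> D u"
    and pos: "\<And>u. 0 \<le> u \<Longrightarrow> u < 1 \<Longrightarrow> D u > 0"
    and zero: "\<And>u. u \<ge> 1 \<Longrightarrow> D u = 0"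
  shows "\<exists>w. greedy_atoms D w"
proof -
  define A where "A s = {x. 0 \<le> x \<and> (\<forall>u. 0 \<le> u \<and> u < s + x \<longrightarrow> x \<le> D u)}" for s
  define g where "g s = Sup (A s)" for s
  have zero_A: "0 \<in> A s" for s
    using pos zero by (auto simp: A_def less_imp_le) (metis less_imp_le not_le order_refl)
  have A_le: "x \<le> 1 - s" if "x \<in> A s" "0 \<le> s" "s \<le> 1" for x s
  proof (rule ccontr)
    assume H: "\<not> ?thesis"
    with that have "x \<le> D 1" by (auto simp: A_def)
    with zero[of 1] H that show False by simp
  qed
  have bdd: "bdd_above (A s)" if "0 \<le> s" "s \<le> 1" for s
    using A_le[OF _ that] by (auto simp: bdd_above_def)
  have g_nonneg: "g s \<ge> 0" if "0 \<le> s" "s \<le> 1" for s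
    unfolding g_def using cSup_upper[OF zero_A bdd[OF that]] .
  have g_le: "s + g s \<le> 1" if "0 \<le> s" "s \<le> 1" for s
  proof -
    have "g s \<le> 1 - s" unfolding g_def using zero_A A_le[OF _ that] by (intro cSup_least) auto
    then show ?thesis by simp
  qed
  have g_below: "g s \<le> D u" if s: "0 \<le> s" "s \<le> 1" and "0 \<le> u" "u < s + g s" for s u
  proof -
    have "u - s < Sup (A s)" using that by (simp add: g_def)
    then obtain x0 where x0: "x0 \<in> A s" "u - s < x0"
      using less_cSup_iff[OF _ bdd[OF s]] zero_A by blast
    have "x \<le> D u" if "x \<in> A s" for x
    proof (cases "x \<le> x0")
      case True
      with x0 \<open>0 \<le> u\<close> show ?thesis by (force simp: A_def)
    next
      case False
      with x0 \<open>0 \<le> u\<close> that show ?thesis by (force simp: A_def)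
    qed
    then show ?thesis unfolding g_def using zero_A by (intro cSup_least) auto
  qed
  have g_above: "D u \<le> g s" if "0 \<le> s" "s \<le> 1" "s + g s < u" for s u
  proof (rule ccontr)
    assume "\<not> D u \<le> g s"
    then have less: "g s < D u" by simp
    \<comment> \<open>Were \<open>D u\<close> larger than \<open>g s\<close>, this length would be
      admissible and exceed the supremum.\<close>
    define x where "x = min (D u) (u - s)"
    have "x \<in> A s"
      unfolding A_def
    proof (intro CollectI conjI allI impI)
      show "0 \<le> x" using less g_nonneg[OF that(1,2)] that by (simp add: x_def)
      fix v assume "0 \<le> v \<and> v < s + x"
      then have "0 \<le> v" "v \<le> u" by (auto simp: x_def)
      then show "x \<le> D v" using mono[of v u] by (simp add: x_def min.coboundedI1)
    qed
    then have "x \<le> g s" unfolding g_def by (rule cSup_upper[OF _ bdd[OF that(1,2)]])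
    with less that show False by (simp add: x_def)
  qed
  define S where "S = rec_nat (0 :: real) (\<lambda>_ s. s + g s)"
  define w where "w k = g (S k)" for k
  have S0: "S 0 = 0" and S_Suc: "S (Suc k) = S k + w k" for k by (simp_all add: S_def w_def)
  have S01: "0 \<le> S k \<and> S k \<le> 1" for k
    using g_nonneg g_le by (induction k) (auto simp: S0 S_Suc w_def)
  have w_nonneg: "w k \<ge> 0" for k using g_nonneg S01 by (simp add: w_def)
  have S_sum: "S k = sum w {..<k}" for k by (induction k) (simp_all add: S0 S_Suc)
  have below: "w k \<le> D u" if "0 \<le> u" "u < sum w {..k}" for k u
    using g_below[of "S k" u] S01[of k] that S_Suc[of k]
    by (simp add: w_def S_sum[of "Suc k", unfolded lessThan_Suc_atMost])
  have above: "D u \<le> w k" if "sum w {..k} < u" for k u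
    using g_above[of "S k" u] S01[of k] that S_Suc[of k]
    by (simp add: w_def S_sum[of "Suc k", unfolded lessThan_Suc_atMost])
  have dec: "decseq w"
  proof (rule decseq_SucI)
    fix k
    show "w (Suc k) \<le> w k"
    proof (cases "w (Suc k) = 0")
      case True
      with w_nonneg[of k] show ?thesis by simp
    next
      case False
      then have "w (Suc k) > 0" using w_nonneg[of "Suc k"] by simp
      then have "sum w {..k} < sum w {..Suc k}" by simp
      then obtain u where u: "sum w {..k} < u" "u < sum w {..Suc k}" using dense by blast
      have "0 \<le> u" using u(1) w_nonneg by (meson less_imp_le order_trans sum_nonneg)
      with below[of u "Suc k"] above[of k u] u show ?thesis by simp
    qed
  qed
  have sum_le: "sum w {..<k} \<le> 1" for k using S01[of k] S_sum by simp
  have summ: "summable w" by (rule summableI_nonneg_bounded[OF w_nonneg sum_le])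
  have "suminf w = 1"
  proof (rule antisym)
    show "suminf w \<le> 1" using summ sum_le by (intro suminf_le_const) auto
    show "1 \<le> suminf w"
    proof (rule ccontr)
      assume "\<not> ?thesis"
      then have "suminf w < 1" by simp
      then obtain u where u: "suminf w < u" "u < 1" using dense by blast
      have u0: "0 \<le> u" using u suminf_nonneg[OF summ w_nonneg] by simp
      \<comment> \<open>At a level \<open>u < 1\<close> beyond all atoms, \<open>D u\<close> would
        be below every \<open>w k\<close>, and these tend to \<open>0\<close>.\<close>
      have "D u \<le> w k" for k
      proof (rule above)
        have "sum w {..k} \<le> suminf w" using sum_le_suminf[OF summ, of "{..k}"] w_nonneg by simp
        with u show "sum w {..k} < u" by simp
      qed
      then have "D u \<le> 0" by (intro LIMSEQ_le_const[OF summable_LIMSEQ_zero[OF summ]]) auto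
      with pos[OF u0 u(2)] show False by simp
    qed
  qed
  with summ have "w sums 1" by (simp add: sums_iff)
  with w_nonneg dec below above have "greedy_atoms D w" by (auto simp: greedy_atoms_def)
  then show ?thesis by blast
qed

section \<open>The quantile function of atom masses\<close>

definition upper_prob :: "'a pmf \<Rightarrow> real \<Rightarrow> real" where
  "upper_prob p l = measure_pmf.prob p {x. pmf p x > l}"

text \<open>The mass of the atom at height \<open>u\<close> when atoms are stacked in decreasing order.\<close>

definition mass_quantile :: "'a pmf \<Rightarrow> real \<Rightarrow> real" where
  "mass_quantile p u = Inf {l. 0 \<le> l \<and> upper_prob p l \<le> u}"

lemma upper_prob_antimono: "l \<le> l' \<Longrightarrow> upper_prob p l' \<le> upper_prob p l"
  unfolding upper_prob_def by (intro measure_pmf.finite_measure_mono) auto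

lemma upper_prob_nonneg: "upper_prob p l \<ge> 0"
  by (simp add: upper_prob_def)

lemma upper_prob_0: "upper_prob p 0 = 1"
  unfolding upper_prob_def by (subst measure_pmf.prob_eq_1) (auto simp: AE_measure_pmf_iff pmf_positive_iff)

lemma upper_prob_1: "upper_prob p 1 = 0"
proof -
  have "{x. pmf p x > 1} = {}" using pmf_le_1[of p] by (auto simp: not_less)
  then show ?thesis by (simp add: upper_prob_def)
qed

lemma upper_prob_right_continuous:
  assumes "u < upper_prob p l"
  obtains l' where "l' > l" "u < upper_prob p l'"
proof -
  have "(\<lambda>k. upper_prob p (l + inverse (Suc k))) \<longlonglongrightarrow> measure_pmf.prob p (\<Union>k. {x. pmf p x > l + inverse (Suc k)})"
    unfolding upper_prob_def
  proof (rule measure_pmf.finite_Lim_measure_incseq)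
    show "incseq (\<lambda>k. {x. pmf p x > l + inverse (Suc k)})"
    proof (rule incseq_SucI, safe)
      fix k x assume "l + inverse (Suc k) < pmf p x"
      moreover have "inverse (real (Suc (Suc k))) \<le> inverse (Suc k)" by (intro le_imp_inverse_le) auto
      ultimately show "l + inverse (Suc (Suc k)) < pmf p x" by linarith
    qed
  qed simp
  also have "(\<Union>k. {x. pmf p x > l + inverse (Suc k)}) = {x. pmf p x > l}"
  proof safe
    fix x k assume "l + inverse (Suc k) < pmf p x"
    moreover have "inverse (real (Suc k)) > 0" by simp
    ultimately show "l < pmf p x" by linarith
  next
    fix x assume "l < pmf p x"
    then obtain k where "inverse (real (Suc k)) < pmf p x - l"
      using reals_Archimedean[of "pmf p x - l"] by auto
    then show "x \<in> (\<Union>k. {x. pmf p x > l + inverse (Suc k)})" by (auto intro!: exI[of _ k])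
  qed
  finally have "(\<lambda>k. upper_prob p (l + inverse (Suc k))) \<longlonglongrightarrow> upper_prob p l"
    by (simp add: upper_prob_def)
  from order_tendstoD(1)[OF this assms] obtain k where "u < upper_prob p (l + inverse (Suc k))"
    by (auto simp: eventually_sequentially)
  then show ?thesis by (intro that[of "l + inverse (Suc k)"]) auto
qed

lemma mass_quantile_nonneg: "u \<ge> 0 \<Longrightarrow> mass_quantile p u \<ge> 0"
  unfolding mass_quantile_def by (intro cInf_greatest) (auto intro!: exI[of _ 1] simp: upper_prob_1)

text \<open>Right continuity of \<open>upper_prob\<close> keeps the infimum strictly above
  \<open>l\<close>, so the two strict inequalities match. The facts on the quantile that follow are
  read off from this.\<close>

lemma less_mass_quantile_iff:
  assumes "u \<ge> 0" "l \<ge> 0"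
  shows "l < mass_quantile p u \<longleftrightarrow> u < upper_prob p l"
proof
  assume "l < mass_quantile p u"
  show "u < upper_prob p l"
  proof (rule ccontr)
    assume "\<not> ?thesis"
    then have "mass_quantile p u \<le> l"
      unfolding mass_quantile_def using assms by (intro cInf_lower) (auto intro!: bdd_belowI[of _ 0])
    with \<open>l < mass_quantile p u\<close> show False by simp
  qed
next
  assume "u < upper_prob p l"
  then obtain l' where l': "l' > l" "u < upper_prob p l'" by (rule upper_prob_right_continuous)
  have "l' \<le> mass_quantile p u"
    unfolding mass_quantile_def
  proof (rule cInf_greatest)
    show "{l. 0 \<le> l \<and> upper_prob p l \<le> u} \<noteq> {}"
      using assms by (auto intro!: exI[of _ 1] simp: upper_prob_1)
    fix x assume "x \<in> {l. 0 \<le> l \<and> upper_prob p l \<le> u}"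
    with l' upper_prob_antimono[of x l' p] show "l' \<le> x" by force
  qed
  with l' show "l < mass_quantile p u" by simp
qed

lemma mass_quantile_antimono:
  assumes "0 \<le> u" "u \<le> v"
  shows "mass_quantile p v \<le> mass_quantile p u"
proof (rule ccontr)
  assume H: "\<not> ?thesis"
  have "mass_quantile p u \<ge> 0" using assms by (intro mass_quantile_nonneg)
  with H less_mass_quantile_iff[of v "mass_quantile p u" p] less_mass_quantile_iff[of u "mass_quantile p u" p] assms
  show False by auto
qed

lemma mass_quantile_pos: "0 \<le> u \<Longrightarrow> u < 1 \<Longrightarrow> mass_quantile p u > 0"
  by (simp add: less_mass_quantile_iff upper_prob_0)

lemma mass_quantile_eq_0: "u \<ge> 1 \<Longrightarrow> mass_quantile p u = 0"
  using less_mass_quantile_iff[of u 0 p] mass_quantile_nonneg[of u p] by (simp add: upper_prob_0)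

lemma mass_quantile_le_1: "u \<ge> 0 \<Longrightarrow> mass_quantile p u \<le> 1"
  using less_mass_quantile_iff[of u 1 p] by (simp add: upper_prob_1)

lemma upper_prob_mass_quantile_le: "u \<ge> 0 \<Longrightarrow> upper_prob p (mass_quantile p u) \<le> u"
  using less_mass_quantile_iff[of u "mass_quantile p u" p] mass_quantile_nonneg[of u p] by simp

subsection \<open>Entropy of one component\<close>

text \<open>The cap makes the information bounded, hence integrable for
  \<open>0 < c \<le> 1\<close>. Lowering \<open>c\<close> step by step splits the entropy into
  layers that can be matched with the greedy atoms.\<close>

definition capped_info :: "'a pmf \<Rightarrow> real \<Rightarrow> real" where
  "capped_info p c = measure_pmf.expectation p (\<lambda>x. min (- log 2 (pmf p x)) (- log 2 c))"

lemma integrable_capped_info: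
  fixes p :: "'a pmf"
  assumes "0 < c" "c \<le> 1"
  shows "integrable p (\<lambda>x. min (- log 2 (pmf p x)) (- log 2 c))"
proof (rule measure_pmf.integrable_const_bound)
  have "norm (min (- log 2 (pmf p x)) (- log 2 c)) \<le> - log 2 c" if "x \<in> set_pmf p" for x
  proof -
    have "0 < pmf p x" using that by (simp add: pmf_positive_iff)
    then have "log 2 (pmf p x) \<le> 0" by (simp add: pmf_le_1)
    moreover have "log 2 c \<le> 0" using assms by simp
    ultimately show ?thesis by (auto simp: min_def)
  qed
  then show "AE x in p. norm (min (- log 2 (pmf p x)) (- log 2 c)) \<le> - log 2 c"
    by (simp add: AE_measure_pmf_iff)
qed simp

lemma capped_info_le_entropy:
  assumes c: "0 < c" "c \<le> 1" and H: "pmf_entropy p = ennreal H" "H \<ge> 0"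
  shows "capped_info p c \<le> H"
proof -
  have nn: "AE x in p. 0 \<le> min (- log 2 (pmf p x)) (- log 2 c)"
    using c by (auto simp: AE_measure_pmf_iff pmf_positive_iff pmf_le_1)
  have "ennreal (capped_info p c) = (\<integral>\<^sup>+x. ennreal (min (- log 2 (pmf p x)) (- log 2 c)) \<partial>p)"
    unfolding capped_info_def
    by (rule nn_integral_eq_integral[symmetric, OF integrable_capped_info[OF c] nn])
  also have "\<dots> \<le> pmf_entropy p"
    unfolding pmf_entropy_def by (intro nn_integral_mono ennreal_leI) simp
  finally show ?thesis using H by (simp add: ennreal_le_iff)
qed

text \<open>Passing from \<open>c\<close> to \<open>c'\<close> raises the capped information by the
  full difference on every atom of mass at most \<open>c'\<close>, and decreases it nowhere.\<close>

lemma capped_info_diff_ge: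
  assumes c: "0 < c'" "c' \<le> c" "c \<le> 1"
  shows "(log 2 c - log 2 c') * (1 - upper_prob p c') \<le> capped_info p c' - capped_info p c"
proof -
  have l: "log 2 c' \<le> log 2 c" using c by simp
  have "(log 2 c - log 2 c') * (1 - upper_prob p c')
      = (log 2 c - log 2 c') * measure_pmf.prob p (- {x. pmf p x > c'})"
    using measure_pmf.prob_compl[of "{x. pmf p x > c'}" p] by (simp add: upper_prob_def Compl_eq_Diff_UNIV)
  also have "\<dots> = measure_pmf.expectation p (\<lambda>x. (log 2 c - log 2 c') * indicator (- {x. pmf p x > c'}) x)"
    by simp
  also have "\<dots> \<le> measure_pmf.expectation p
      (\<lambda>x. min (- log 2 (pmf p x)) (- log 2 c') - min (- log 2 (pmf p x)) (- log 2 c))"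
  proof (rule integral_mono_AE)
    show "integrable p (\<lambda>x. (log 2 c - log 2 c') * indicator (- {x. pmf p x > c'}) x)"
      by (intro integrable_mult_right) (auto simp: integrable_indicator_iff measure_pmf.emeasure_eq_measure)
    show "integrable p (\<lambda>x. min (- log 2 (pmf p x)) (- log 2 c') - min (- log 2 (pmf p x)) (- log 2 c))"
      using c by (intro Bochner_Integration.integrable_diff integrable_capped_info) auto
    have "(log 2 c - log 2 c') * indicator (- {x. pmf p x > c'}) x
      \<le> min (- log 2 (pmf p x)) (- log 2 c') - min (- log 2 (pmf p x)) (- log 2 c)" if "x \<in> set_pmf p" for x
    proof (cases "pmf p x > c'")
      case True
      with l show ?thesis by simp
    next
      case False
      have "0 < pmf p x" using that by (simp add: pmf_positive_iff)
      with False c have "log 2 (pmf p x) \<le> log 2 c'" by simp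
      with False l show ?thesis by (simp add: min_def)
    qed
    then show "AE x in p. (log 2 c - log 2 c') * indicator (- {x. pmf p x > c'}) x
      \<le> min (- log 2 (pmf p x)) (- log 2 c') - min (- log 2 (pmf p x)) (- log 2 c)"
      by (simp add: AE_measure_pmf_iff)
  qed
  also have "\<dots> = capped_info p c' - capped_info p c"
    unfolding capped_info_def using c
    by (intro Bochner_Integration.integral_diff integrable_capped_info) auto
  finally show ?thesis .
qed

lemma capped_info_1: "capped_info p 1 = 0"
proof -
  have "min (- log 2 (pmf p x)) (- log 2 1) = 0" if "x \<in> set_pmf p" for x
  proof -
    have "0 < pmf p x" using that by (simp add: pmf_positive_iff)
    then have "log 2 (pmf p x) \<le> 0" by (simp add: pmf_le_1)
    then show ?thesis by simp
  qed
  then have "capped_info p 1 = measure_pmf.expectation p (\<lambda>x. 0)"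
    unfolding capped_info_def by (intro integral_cong_AE) (auto simp: AE_measure_pmf_iff)
  then show ?thesis by simp
qed

text \<open>The indices form an initial segment, whose mass is a partial sum. In other words, the
  right end of a random atom is stochastically at least uniform.\<close>

lemma prob_partial_sums_le:
  fixes W :: "nat pmf"
  assumes "\<tau> \<ge> 0"
  shows "measure_pmf.prob W {k. sum (pmf W) {..k} \<le> \<tau>} \<le> \<tau>"
proof -
  let ?K = "{k. sum (pmf W) {..k} \<le> \<tau>}"
  have "(\<lambda>m. measure_pmf.prob W (?K \<inter> {..<m})) \<longlonglongrightarrow> measure_pmf.prob W (\<Union>m. ?K \<inter> {..<m})"
    by (intro measure_pmf.finite_Lim_measure_incseq) (auto simp: incseq_def)
  moreover have "(\<Union>m. ?K \<inter> {..<m}) = ?K" by auto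
  moreover have "measure_pmf.prob W (?K \<inter> {..<m}) \<le> \<tau>" for m
  proof (cases "?K \<inter> {..<m} = {}")
    case False
    let ?k = "Max (?K \<inter> {..<m})"
    have "?k \<in> ?K \<inter> {..<m}" using False by (intro Max_in) auto
    moreover have "measure_pmf.prob W (?K \<inter> {..<m}) \<le> measure_pmf.prob W {..?k}"
      by (intro measure_pmf.finite_measure_mono) auto
    ultimately show ?thesis by (simp add: measure_measure_pmf_finite)
  qed (use assms in simp)
  ultimately show ?thesis by (intro LIMSEQ_le_const2) auto
qed

text \<open>The root shares the base information equally among the components. The level is the
  probability that \<open>n\<close> independent uniform levels all stay below
  \<open>1 - 1 / n\<close>, up to which \<open>component_bound\<close> is constant.\<close>

definition base_mass :: "'a pmf \<Rightarrow> nat \<Rightarrow> real" where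
  "base_mass p n = root n (mass_quantile p ((1 - 1 / n) ^ n))"

text \<open>Minus the logarithm of this bound is \<open>k / n + max 0 (\<iota> (u ^ n) - k)\<close>, where \<open>\<iota>\<close> is the quantile
  function of the information of \<open>p\<close> and \<open>k = \<iota> ((1 - 1 / n) ^ n)\<close>. For independent uniform levels
  \<open>u\<close> the largest \<open>u ^ n\<close> is again uniform, so the components together carry at least as much
  information as \<open>p\<close>.\<close>

definition component_bound :: "'a pmf \<Rightarrow> nat \<Rightarrow> real \<Rightarrow> real" where
  "component_bound p n u = min (base_mass p n) (mass_quantile p (u ^ n) / base_mass p n ^ (n - 1))"

text \<open>Factoring out \<open>1 - s\<close> leaves two geometric sums, compared term by term,
  with equality at \<open>s = 1 - 1 / n\<close>. This is the source of the factor in front of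
  \<open>H(X) / n\<close>.\<close>

lemma one_minus_le_one_minus_power:
  fixes s :: real and n :: nat
  assumes n: "n \<ge> 1" and s: "1 - 1 / n \<le> s" "s \<le> 1"
  shows "(1 - s) * (n * (1 - (1 - 1 / n) ^ n)) \<le> 1 - s ^ n"
proof -
  have "n * (1 - (1 - 1 / n) ^ n) = (\<Sum>i<n. (1 - 1 / n) ^ i)"
    using n by (simp add: one_diff_power_eq)
  also have "\<dots> \<le> (\<Sum>i<n. s ^ i)" using n s by (intro sum_mono power_mono) auto
  finally have "(1 - s) * (n * (1 - (1 - 1 / n) ^ n)) \<le> (1 - s) * (\<Sum>i<n. s ^ i)"
    using s by (intro mult_left_mono) auto
  then show ?thesis by (simp add: one_diff_power_eq)
qed

context
  fixes p :: "'a pmf" and n :: nat and q a \<phi> :: real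
  assumes n: "n \<ge> 1"
  defines "q \<equiv> (1 - 1 / n) ^ n" and "a \<equiv> base_mass p n" and "\<phi> \<equiv> 1 / (1 - (1 - 1 / n) ^ n)"
begin

lemma base_level: "0 \<le> q" "q < 1"
proof -
  show "0 \<le> q" using n by (simp add: q_def)
  have "0 < 1 / real n" "1 / real n \<le> 1" using n by auto
  then have "(1 - 1 / n) ^ n < 1 ^ n" using n by (intro power_strict_mono) auto
  then show "q < 1" by (simp add: q_def)
qed

lemma gap_factor: "\<phi> > 0" "\<phi> * (1 - q) = 1"
  using base_level by (simp_all add: \<phi>_def flip: q_def)

lemma base_mass_bounds: "0 < a" "a \<le> 1" "a ^ n = mass_quantile p q"
proof -
  have "mass_quantile p q > 0" "mass_quantile p q \<le> 1"
    using base_level by (auto intro: mass_quantile_pos mass_quantile_le_1)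
  then show "0 < a" "a \<le> 1" "a ^ n = mass_quantile p q"
    using n by (auto simp: a_def base_mass_def q_def[symmetric])
qed

lemma power_base_mass: "a ^ (n - 1) * a = a ^ n"
  using n by (metis Suc_diff_1 less_le_trans power_Suc2 zero_less_one)

lemma component_bound_antimono:
  "0 \<le> u \<Longrightarrow> u \<le> v \<Longrightarrow> component_bound p n v \<le> component_bound p n u"
  unfolding component_bound_def a_def[symmetric]
  using base_mass_bounds by (intro min.mono order_refl divide_right_mono mass_quantile_antimono power_mono) auto

lemma component_bound_pos: "0 \<le> u \<Longrightarrow> u < 1 \<Longrightarrow> component_bound p n u > 0"
  unfolding component_bound_def a_def[symmetric]
  using base_mass_bounds n power_strict_mono[of u 1 n] by (auto intro!: divide_pos_pos mass_quantile_pos)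

lemma component_bound_eq_0: "u \<ge> 1 \<Longrightarrow> component_bound p n u = 0"
  unfolding component_bound_def a_def[symmetric]
  using base_mass_bounds by (simp add: mass_quantile_eq_0 one_le_power)

lemma component_bound_le: "component_bound p n u \<le> a" "a ^ (n - 1) * component_bound p n u \<le> mass_quantile p (u ^ n)"
proof -
  show "component_bound p n u \<le> a" by (simp add: component_bound_def a_def)
  have "component_bound p n u \<le> mass_quantile p (u ^ n) / a ^ (n - 1)"
    by (simp add: component_bound_def a_def)
  then show "a ^ (n - 1) * component_bound p n u \<le> mass_quantile p (u ^ n)"
    using base_mass_bounds(1) by (simp add: pos_le_divide_eq mult.commute)
qed

lemma component_bound_eq_base_mass:
  assumes "0 \<le> u" "u \<le> 1 - 1 / n"
  shows "component_bound p n u = a"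
proof -
  have "a ^ n \<le> mass_quantile p (u ^ n)"
    unfolding base_mass_bounds(3) q_def using assms by (intro mass_quantile_antimono power_mono) auto
  then have "a \<le> mass_quantile p (u ^ n) / a ^ (n - 1)"
    using base_mass_bounds(1) power_base_mass by (simp add: pos_le_divide_eq mult.commute)
  then show ?thesis by (simp add: component_bound_def a_def)
qed

section \<open>Rounding the component bound to an actual law\<close>

context
  fixes w :: "nat \<Rightarrow> real"
  assumes w: "greedy_atoms (component_bound p n) w"
begin

lemma greedy_nonneg: "w k \<ge> 0" and greedy_decseq: "decseq w" and greedy_sums: "w sums 1"
  and greedy_below: "0 \<le> u \<Longrightarrow> u < sum w {..k} \<Longrightarrow> w k \<le> component_bound p n u"
  and greedy_above: "sum w {..k} < u \<Longrightarrow> component_bound p n u \<le> w k"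
  using w by (auto simp: greedy_atoms_def)

lemma greedy_le_base_mass: "w k \<le> a"
proof (cases "w k = 0")
  case True
  with base_mass_bounds show ?thesis by simp
next
  case False
  then have "0 < w k" using greedy_nonneg[of k] by simp
  also have "w k \<le> sum w {..k}" using greedy_nonneg by (intro member_le_sum) auto
  finally have "w k \<le> component_bound p n 0" by (intro greedy_below) auto
  also have "\<dots> \<le> a" by (rule component_bound_le)
  finally show ?thesis .
qed

lemma greedy_partial_sums: "0 \<le> sum w {..k}" "sum w {..k} \<le> 1"
proof -
  show "0 \<le> sum w {..k}" using greedy_nonneg by (intro sum_nonneg) auto
  have "sum w {..k} \<le> suminf w"
    using greedy_sums greedy_nonneg by (intro sum_le_suminf) (auto simp: sums_iff)
  then show "sum w {..k} \<le> 1" using greedy_sums by (simp add: sums_iff)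
qed

text \<open>Put \<open>\<tau> ^ n = upper_prob p l\<close>. All coordinates of a cell heavier than
  \<open>l\<close> end at or before \<open>\<tau>\<close>: one ending later has mass at most
  \<open>component_bound p n \<tau>\<close>, the others at most \<open>a\<close>, and the product
  would be at most the quantile at \<open>\<tau> ^ n\<close>, hence at most \<open>l\<close>. By
  independence this has probability at most \<open>\<tau> ^ n\<close>.\<close>

lemma prob_product_le_upper_prob:
  fixes W :: "nat pmf" and d :: nat
  assumes W: "\<And>k. pmf W k = w k" and l: "l \<ge> 0"
  defines "C \<equiv> Pi_pmf {1..n} d (\<lambda>_. W)"
  shows "measure_pmf.prob C {j. pmf C j > l} \<le> measure_pmf.prob p {x. pmf p x > l}"
proof -
  define \<tau> where "\<tau> = root n (upper_prob p l)"
  have \<tau>: "\<tau> \<ge> 0" "\<tau> ^ n = upper_prob p l"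
    using n upper_prob_nonneg[of p l] by (auto simp: \<tau>_def)
  have "sum w {..j i} \<le> \<tau>" if j: "pmf C j > l" and i: "i \<in> {1..n}" for j i
  proof (rule ccontr)
    assume H: "\<not> ?thesis"
    have "\<not> (\<exists>x. x \<notin> {1..n} \<and> j x \<noteq> d)"
      using j l by (auto simp: C_def pmf_Pi split: if_splits)
    then have "pmf C j = (\<Prod>x\<in>{1..n}. w (j x))"
      unfolding C_def by (subst pmf_Pi) (auto simp: W)
    also have "\<dots> = w (j i) * (\<Prod>x\<in>{1..n} - {i}. w (j x))"
      using i by (subst prod.remove[of _ i]) auto
    also have "\<dots> \<le> component_bound p n \<tau> * a ^ (n - 1)"
    proof (rule mult_mono)
      show "w (j i) \<le> component_bound p n \<tau>" using H \<tau> by (intro greedy_below) auto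
      have "(\<Prod>x\<in>{1..n} - {i}. w (j x)) \<le> (\<Prod>x\<in>{1..n} - {i}. a)"
        using greedy_nonneg greedy_le_base_mass by (intro prod_mono) auto
      then show "(\<Prod>x\<in>{1..n} - {i}. w (j x)) \<le> a ^ (n - 1)" using i by simp
      show "0 \<le> component_bound p n \<tau>"
        using component_bound_pos[of \<tau>] component_bound_eq_0[of \<tau>] \<tau> by force
    qed (use greedy_nonneg in \<open>auto intro: prod_nonneg\<close>)
    also have "\<dots> \<le> mass_quantile p (upper_prob p l)"
      using component_bound_le(2)[of \<tau>] \<tau> by (simp add: mult.commute)
    finally have "l < mass_quantile p (upper_prob p l)" using j by simp
    then show False using l upper_prob_nonneg[of p l] by (simp add: less_mass_quantile_iff)
  qed
  then have "measure_pmf.prob C {j. pmf C j > l} \<le> measure_pmf.prob C (Pi {1..n} (\<lambda>_. {k. sum w {..k} \<le> \<tau>}))"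
    by (intro measure_pmf.finite_measure_mono) auto
  also have "\<dots> = measure_pmf.prob W {k. sum w {..k} \<le> \<tau>} ^ n"
    unfolding C_def by (subst measure_Pi_pmf_Pi) auto
  also have "\<dots> \<le> \<tau> ^ n"
    using prob_partial_sums_le[OF \<tau>(1), of W] by (intro power_mono) (auto simp: W)
  finally show ?thesis using \<tau> by (simp add: upper_prob_def)
qed

text \<open>Beyond atom \<open>m\<close> the bound is below \<open>a\<close>, so there it is its
  quantile term; this gives \<open>upper_prob p (a ^ (n - 1) * w m) \<le> u ^ n\<close> for every
  \<open>u\<close> past the partial sum, and then for the sum itself. The sum is at least
  \<open>1 - 1 / n\<close>, as the bound equals \<open>a\<close> up to that level, so
  \<open>one_minus_le_one_minus_power\<close> applies.\<close>

lemma one_minus_partial_sum_le: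
  assumes "w m < a"
  shows "1 - sum w {..m} \<le> \<phi> / n * (1 - upper_prob p (a ^ (n - 1) * w m))"
proof -
  let ?S = "sum w {..m}" and ?c = "a ^ (n - 1) * w m"
  have c: "?c \<ge> 0" using base_mass_bounds greedy_nonneg by simp
  have up: "upper_prob p ?c \<le> u ^ n" if "u > ?S" for u
  proof -
    have "component_bound p n u \<le> w m" using that by (rule greedy_above)
    with assms have "mass_quantile p (u ^ n) / a ^ (n - 1) \<le> w m"
      by (auto simp: component_bound_def a_def)
    then have "mass_quantile p (u ^ n) \<le> ?c"
      using base_mass_bounds(1) by (simp add: pos_divide_le_eq mult.commute)
    moreover have "u \<ge> 0" using that greedy_partial_sums(1)[of m] by simp
    ultimately show ?thesis using c less_mass_quantile_iff[of "u ^ n" ?c p] by simp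
  qed
  have le: "upper_prob p ?c \<le> ?S ^ n"
  proof (rule ccontr)
    assume H: "\<not> ?thesis"
    define \<tau> where "\<tau> = root n (upper_prob p ?c)"
    have \<tau>: "\<tau> \<ge> 0" "\<tau> ^ n = upper_prob p ?c"
      using n upper_prob_nonneg[of p ?c] by (auto simp: \<tau>_def)
    have "?S < \<tau>" using H \<tau> greedy_partial_sums(1)[of m] by (metis linorder_not_le power_mono)
    then obtain u where u: "?S < u" "u < \<tau>" using dense by blast
    then have "u ^ n < \<tau> ^ n" using n greedy_partial_sums(1)[of m] by (intro power_strict_mono) auto
    with up[OF u(1)] \<tau> show False by simp
  qed
  have "1 - 1 / n \<le> ?S"
  proof (rule ccontr)
    assume "\<not> ?thesis"
    then obtain u where u: "?S < u" "u < 1 - 1 / n" using dense by (metis linorder_not_le)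
    with greedy_above[of m u] component_bound_eq_base_mass[of u] greedy_partial_sums(1)[of m] assms
    show False by simp
  qed
  from one_minus_le_one_minus_power[OF n this greedy_partial_sums(2)]
  have "(1 - ?S) * (n * (1 - q)) \<le> 1 - ?S ^ n" by (simp add: q_def)
  with le have "(1 - ?S) * (n * (1 - q)) \<le> 1 - upper_prob p ?c" by simp
  then have "\<phi> / n * ((1 - ?S) * (n * (1 - q))) \<le> \<phi> / n * (1 - upper_prob p ?c)"
    using gap_factor(1) by (intro mult_left_mono) auto
  moreover have "\<phi> / n * ((1 - ?S) * (n * (1 - q))) = (1 - ?S) * (\<phi> * (1 - q))"
    using n by simp
  ultimately show ?thesis using gap_factor(2) by simp
qed

text \<open>Moving from atom \<open>m\<close> to \<open>Suc m\<close> adds the uncovered mass times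
  the gain in information. By \<open>one_minus_partial_sum_le\<close> and
  \<open>capped_info_diff_ge\<close> this is at most \<open>\<phi> / n\<close> times the growth of
  the capped information, and the growths telescope.\<close>

lemma shifted_info_sum_le:
  assumes "w m > 0"
  shows "(\<Sum>k<m. w (Suc k) * - log 2 (w k)) + (1 - sum w {..m}) * - log 2 (w m)
    \<le> \<phi> / n * capped_info p (a ^ (n - 1) * w m)"
  using assms
proof (induction m)
  case 0
  \<comment> \<open>In the base case the cap moves twice, from \<open>1\<close> to
    \<open>a ^ n\<close> and then to \<open>a ^ (n - 1) * w 0\<close>; this is the second
    move.\<close>
  have step: "(1 - sum w {..0}) * (log 2 a - log 2 (w 0))
    \<le> \<phi> / n * (capped_info p (a ^ (n - 1) * w 0) - capped_info p (a ^ n))"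
  proof (cases "w 0 = a")
    case True
    show ?thesis unfolding True power_base_mass by simp
  next
    case False
    then have less: "w 0 < a" using greedy_le_base_mass[of 0] by simp
    have "log 2 (a ^ n) - log 2 (a ^ (n - 1) * w 0) = log 2 a - log 2 (w 0)"
      using base_mass_bounds(1) 0 by (simp add: log_mult power_base_mass[symmetric])
    moreover have "(log 2 (a ^ n) - log 2 (a ^ (n - 1) * w 0)) * (1 - upper_prob p (a ^ (n - 1) * w 0))
      \<le> capped_info p (a ^ (n - 1) * w 0) - capped_info p (a ^ n)"
    proof (rule capped_info_diff_ge)
      show "0 < a ^ (n - 1) * w 0" using base_mass_bounds 0 by simp
      show "a ^ (n - 1) * w 0 \<le> a ^ n"
        unfolding power_base_mass[symmetric] using base_mass_bounds greedy_le_base_mass[of 0]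
        by (intro mult_left_mono) auto
      show "a ^ n \<le> 1" using base_mass_bounds(1,2) by (intro power_le_one) auto
    qed
    ultimately have "\<phi> / n * ((log 2 a - log 2 (w 0)) * (1 - upper_prob p (a ^ (n - 1) * w 0)))
      \<le> \<phi> / n * (capped_info p (a ^ (n - 1) * w 0) - capped_info p (a ^ n))"
      using gap_factor(1) by (intro mult_left_mono) auto
    moreover have "(1 - sum w {..0}) * (log 2 a - log 2 (w 0))
      \<le> \<phi> / n * (1 - upper_prob p (a ^ (n - 1) * w 0)) * (log 2 a - log 2 (w 0))"
      using one_minus_partial_sum_le[OF less] less 0 base_mass_bounds
      by (intro mult_right_mono) auto
    ultimately show ?thesis by (simp only: ac_simps)
  qed
  \<comment> \<open>The first move: the mass of a random atom of \<open>p\<close> is at most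
    \<open>a ^ n\<close> with probability at least \<open>1 - q\<close>, and
    \<open>\<phi> * (1 - q) = 1\<close>.\<close>
  have "(1 - sum w {..0}) * - log 2 a \<le> 1 * - log 2 a"
    using greedy_partial_sums[of 0] base_mass_bounds by (intro mult_right_mono) auto
  also have "\<dots> = \<phi> / n * ((1 - q) * (n * - log 2 a))"
    using n gap_factor(2) by simp
  also have "\<dots> \<le> \<phi> / n * capped_info p (a ^ n)"
  proof (rule mult_left_mono)
    have "(1 - q) * (n * - log 2 a) \<le> (1 - upper_prob p (a ^ n)) * (n * - log 2 a)"
      using upper_prob_mass_quantile_le[OF base_level(1), of p] base_mass_bounds
      by (intro mult_right_mono mult_nonneg_nonneg) auto
    also have "\<dots> \<le> capped_info p (a ^ n)"
      using capped_info_diff_ge[of "a ^ n" 1 p] base_mass_bounds(1,2)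
      by (simp add: capped_info_1 power_le_one log_nat_power mult.commute)
    finally show "(1 - q) * (n * - log 2 a) \<le> capped_info p (a ^ n)" .
  qed (use gap_factor in simp)
  finally have "(1 - sum w {..0}) * - log 2 a + (1 - sum w {..0}) * (log 2 a - log 2 (w 0))
      \<le> \<phi> / n * capped_info p (a ^ n) + \<phi> / n * (capped_info p (a ^ (n - 1) * w 0) - capped_info p (a ^ n))"
    using step by (rule add_mono)
  then show ?case by (simp add: algebra_simps)
next
  case (Suc m)
  have le: "w (Suc m) \<le> w m" using greedy_decseq by (simp add: decseq_Suc_iff)
  with Suc.prems have wm: "w m > 0" by simp
  let ?c = "\<lambda>m. a ^ (n - 1) * w m"
  have step: "(1 - sum w {..Suc m}) * (log 2 (w m) - log 2 (w (Suc m)))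
    \<le> \<phi> / n * (capped_info p (?c (Suc m)) - capped_info p (?c m))"
  proof (cases "w (Suc m) = w m")
    case False
    with le greedy_le_base_mass[of m] have less: "w (Suc m) < a" by simp
    have "log 2 (?c m) - log 2 (?c (Suc m)) = log 2 (w m) - log 2 (w (Suc m))"
      using base_mass_bounds(1) wm Suc.prems by (simp add: log_mult)
    moreover have "?c m \<le> 1"
      using base_mass_bounds greedy_le_base_mass[of m] greedy_nonneg by (intro mult_le_one power_le_one) auto
    then have "(log 2 (?c m) - log 2 (?c (Suc m))) * (1 - upper_prob p (?c (Suc m)))
      \<le> capped_info p (?c (Suc m)) - capped_info p (?c m)"
      using base_mass_bounds Suc.prems le by (intro capped_info_diff_ge) auto
    ultimately have "\<phi> / n * ((log 2 (w m) - log 2 (w (Suc m))) * (1 - upper_prob p (?c (Suc m))))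
      \<le> \<phi> / n * (capped_info p (?c (Suc m)) - capped_info p (?c m))"
      using gap_factor(1) by (intro mult_left_mono) auto
    moreover have "(1 - sum w {..Suc m}) * (log 2 (w m) - log 2 (w (Suc m)))
      \<le> \<phi> / n * (1 - upper_prob p (?c (Suc m))) * (log 2 (w m) - log 2 (w (Suc m)))"
      using one_minus_partial_sum_le[OF less] le wm Suc.prems by (intro mult_right_mono) auto
    ultimately show ?thesis by (simp only: ac_simps)
  qed simp
  have "sum w {..Suc m} = sum w {..m} + w (Suc m)" by simp
  then have "(\<Sum>k<Suc m. w (Suc k) * - log 2 (w k)) + (1 - sum w {..Suc m}) * - log 2 (w (Suc m))
    = (\<Sum>k<m. w (Suc k) * - log 2 (w k)) + (1 - sum w {..m}) * - log 2 (w m)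
      + (1 - sum w {..Suc m}) * (log 2 (w m) - log 2 (w (Suc m)))"
    unfolding sum.lessThan_Suc by (simp only: algebra_simps)
  also have "\<dots> \<le> \<phi> / n * capped_info p (?c m) + \<phi> / n * (capped_info p (?c (Suc m)) - capped_info p (?c m))"
    by (intro add_mono Suc.IH wm step)
  also have "\<dots> = \<phi> / n * capped_info p (?c (Suc m))" by (simp add: algebra_simps)
  finally show ?case .
qed

text \<open>Gibbs' inequality against the weights \<open>w k * (1 - w 0)\<close> at \<open>Suc k\<close>.\<close>

lemma partial_entropy_le_shifted:
  assumes "w m > 0"
  shows "(\<Sum>k<Suc m. - w k * log 2 (w k))
    \<le> - w 0 * log 2 (w 0) + (\<Sum>k<m. w (Suc k) * - log 2 (w k))
      - (sum w {..m} - w 0) * log 2 (1 - w 0)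
      + log 2 (exp 1) * ((1 - w 0) * sum w {..<m} - (sum w {..m} - w 0))"
  using assms
proof (induction m)
  case (Suc m)
  have le: "w (Suc m) \<le> w m" using greedy_decseq by (simp add: decseq_Suc_iff)
  with Suc.prems have wm: "w m > 0" by simp
  let ?x = "w (Suc m)" and ?y = "w m" and ?d = "1 - w 0" and ?e = "log 2 (exp 1)"
  have "w 0 + ?x = sum w {0, Suc m}" by simp
  also have "\<dots> \<le> sum w {..Suc m}" using greedy_nonneg by (intro sum_mono2) auto
  also have "\<dots> \<le> 1" by (rule greedy_partial_sums)
  finally have d: "?d > 0" using Suc.prems by simp
  have "log 2 (?y * ?d / ?x) \<le> (?y * ?d / ?x - 1) * ?e"
    using Suc.prems wm d by (intro log2_le_sub_one) auto
  moreover have "log 2 (?y * ?d / ?x) = log 2 ?y + log 2 ?d - log 2 ?x"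
    using Suc.prems wm d by (simp add: log_mult log_divide)
  ultimately have "?x * (log 2 ?y + log 2 ?d - log 2 ?x) \<le> ?x * ((?y * ?d / ?x - 1) * ?e)"
    using Suc.prems by (intro mult_left_mono) auto
  also have "\<dots> = ?e * (?d * ?y - ?x)"
  proof -
    have "x * (y * d / x - 1) = d * y - x" if "x > 0" for x y d :: real
      using that by (simp add: field_simps)
    from this[OF Suc.prems] have "?x * (?y * ?d / ?x - 1) = ?d * ?y - ?x" .
    then show ?thesis by (metis mult.assoc mult.commute)
  qed
  finally have "- ?x * log 2 ?x \<le> ?x * - log 2 ?y - ?x * log 2 ?d + ?e * (?d * ?y - ?x)"
    by (simp only: algebra_simps)
  moreover have id: "A + (B + X) - (S + x - w0) * L + e * (D * (T + y) - (S + x - w0))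
    = (A + B - (S - w0) * L + e * (D * T - (S - w0))) + (X - x * L + e * (D * y - x))" for A B X S x w0 L e D T y :: real
    by (simp add: algebra_simps)
  ultimately show ?case using Suc.IH[OF wm]
    unfolding sum.lessThan_Suc[of _ "Suc m"] sum.lessThan_Suc[of "\<lambda>k. w (Suc k) * - log 2 (w k)"]
      sum.lessThan_Suc[of w] sum.atMost_Suc id by linarith
qed simp

text \<open>The shifted sum is at most \<open>\<phi> * (H / n)\<close>. The Gibbs step from it to
  the entropy costs \<open>binary_entropy (w 0)\<close>, up to a correction that vanishes as the
  partial sums tend to one. The second claim is the shifted bound at \<open>m = 0\<close> with the
  logarithm replaced by its tangent.\<close>

lemma entropy_of_greedy_atoms:
  fixes W :: "nat pmf"
  assumes W: "\<And>k. pmf W k = w k" and H: "pmf_entropy p = ennreal H" "H \<ge> 0"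
  shows "pmf_entropy W \<le> ennreal (\<phi> * (H / n) + binary_entropy (w 0))"
    and "(1 - w 0)\<^sup>2 * log 2 (exp 1) \<le> \<phi> * (H / n)"
    and "0 \<le> w 0 \<and> w 0 \<le> 1"
proof -
  let ?B = "\<phi> * (H / n) + binary_entropy (w 0)" and ?e = "log 2 (exp 1)"
  have e: "?e > 0" by simp
  have w1: "w k \<le> 1" for k using W[of k] pmf_le_1[of W k] by simp
  have "w 0 \<noteq> 0"
  proof
    assume "w 0 = 0"
    then have "w k = 0" for k using greedy_decseq greedy_nonneg[of k] by (metis antisym decseqD le0)
    then have "w = (\<lambda>_. 0)" by auto
    then have "w sums 0" by simp
    with greedy_sums show False by (simp add: sums_iff)
  qed
  with greedy_nonneg[of 0] have w0: "w 0 > 0" by simp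
  show "0 \<le> w 0 \<and> w 0 \<le> 1" using w0 w1 by simp
  have bound: "(\<Sum>k<m. w (Suc k) * - log 2 (w k)) + (1 - sum w {..m}) * - log 2 (w m) \<le> \<phi> * (H / n)"
    if "w m > 0" for m
  proof -
    have "a ^ (n - 1) * w m \<le> 1"
      using base_mass_bounds w1[of m] greedy_nonneg by (intro mult_le_one power_le_one) auto
    then have "capped_info p (a ^ (n - 1) * w m) \<le> H"
      using base_mass_bounds that by (intro capped_info_le_entropy H) auto
    then have "\<phi> / n * capped_info p (a ^ (n - 1) * w m) \<le> \<phi> / n * H"
      using gap_factor by (intro mult_left_mono) auto
    with shifted_info_sum_le[OF that] show ?thesis by simp
  qed
  have "(1 - w 0) * ((1 - w 0) * ?e) \<le> (1 - w 0) * - log 2 (w 0)"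
    using log2_le_sub_one[OF w0] w1[of 0] by (intro mult_left_mono) (auto simp: algebra_simps diff_divide_distrib)
  with bound[OF w0] show "(1 - w 0)\<^sup>2 * ?e \<le> \<phi> * (H / n)"
    by (simp add: power2_eq_square mult.assoc)
  show "pmf_entropy W \<le> ennreal ?B"
  proof (rule pmf_entropy_nat_le)
    have "(\<lambda>m. ?B + ?e * (1 - sum w {..<m})) \<longlonglongrightarrow> ?B + ?e * (1 - 1)"
      using greedy_sums unfolding sums_def by (intro tendsto_intros)
    then show "(\<lambda>m. ?B + ?e * (1 - sum w {..<m})) \<longlonglongrightarrow> ?B" by simp
    fix m
    have "(\<Sum>k<m. - w k * log 2 (w k)) \<le> ?B + ?e * (1 - sum w {..<m})"
    proof (induction m)
      case 0
      have "0 \<le> binary_entropy (w 0)" using w0 w1 by (intro binary_entropy_nonneg) auto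
      moreover have "0 \<le> \<phi> * (H / n)" using gap_factor H by simp
      ultimately show ?case using e by simp
    next
      case (Suc m)
      show ?case
      proof (cases "w m = 0")
        case True
        with Suc show ?thesis by simp
      next
        case False
        with greedy_nonneg[of m] have wm: "w m > 0" by simp
        have S: "w 0 \<le> sum w {..m}" using greedy_nonneg by (intro member_le_sum) auto
        have "0 \<le> (1 - sum w {..m}) * - log 2 (w m)"
          using greedy_partial_sums[of m] wm w1[of m] by (intro mult_nonneg_nonneg) auto
        moreover have "- (sum w {..m} - w 0) * log 2 (1 - w 0) \<le> - (1 - w 0) * log 2 (1 - w 0)"
        proof (cases "w 0 = 1")
          case False
          then have "log 2 (1 - w 0) \<le> 0" using w0 w1[of 0] by simp
          moreover have "- (1 - w 0) \<le> - (sum w {..m} - w 0)" using greedy_partial_sums[of m] by simp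
          ultimately show ?thesis by (intro mult_right_mono_neg)
        next
          case True
          with S greedy_partial_sums[of m] have "sum w {..m} = 1" by simp
          with True show ?thesis by simp
        qed
        moreover have "?e * ((1 - w 0) * sum w {..<m} - (sum w {..m} - w 0)) \<le> ?e * (1 - sum w {..m})"
        proof (rule mult_left_mono)
          have "sum w {..<m} \<le> sum w {..m}" using greedy_nonneg by (intro sum_mono2) auto
          then have "(1 - w 0) * sum w {..<m} \<le> (1 - w 0) * 1"
            using w1[of 0] greedy_partial_sums[of m] by (intro mult_left_mono) auto
          then show "(1 - w 0) * sum w {..<m} - (sum w {..m} - w 0) \<le> 1 - sum w {..m}" by simp
        qed (use e in simp)
        ultimately show ?thesis
          using partial_entropy_le_shifted[OF wm] bound[OF wm]
          unfolding lessThan_Suc_atMost binary_entropy_def by linarith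
      qed
    qed
    then show "(\<Sum>k<m. - pmf W k * log 2 (pmf W k)) \<le> ?B + ?e * (1 - sum w {..<m})" by (simp add: W)
  qed
qed

end

end

subsection \<open>The representation\<close>

text \<open>The splitting map is injective, so masses are compared function by function.\<close>

lemma Pi_pmf_pair_pmf:
  assumes A: "finite A"
  shows "map_pmf (\<lambda>h. (fst \<circ> h, snd \<circ> h)) (Pi_pmf A (c, d) (\<lambda>_. pair_pmf p q))
    = pair_pmf (Pi_pmf A c (\<lambda>_. p)) (Pi_pmf A d (\<lambda>_. q))"
proof (rule pmf_eqI)
  fix z :: "('a \<Rightarrow> 'b) \<times> ('a \<Rightarrow> 'c)"
  obtain u v where z: "z = (u, v)" by (cases z)
  let ?split = "\<lambda>h :: 'a \<Rightarrow> 'b \<times> 'c. (fst \<circ> h, snd \<circ> h)"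
  have inj: "inj ?split" by (auto simp: inj_def fun_eq_iff prod_eq_iff)
  have "z = ?split (\<lambda>x. (u x, v x))" by (simp add: z fun_eq_iff)
  then have "pmf (map_pmf ?split (Pi_pmf A (c, d) (\<lambda>_. pair_pmf p q))) z
      = pmf (Pi_pmf A (c, d) (\<lambda>_. pair_pmf p q)) (\<lambda>x. (u x, v x))"
    by (simp only: pmf_map_inj'[OF inj])
  also have "\<dots> = pmf (Pi_pmf A c (\<lambda>_. p)) u * pmf (Pi_pmf A d (\<lambda>_. q)) v"
    by (auto simp: pmf_Pi[OF A] pmf_pair prod.distrib)
  finally show "pmf (map_pmf ?split (Pi_pmf A (c, d) (\<lambda>_. pair_pmf p q))) z
      = pmf (pair_pmf (Pi_pmf A c (\<lambda>_. p)) (Pi_pmf A d (\<lambda>_. q))) z"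
    by (simp add: z pmf_pair)
qed

text \<open>A law carried by a countable set is concentrated on its atoms, so it is a
  \<open>pmf\<close> even on an uncountable type.\<close>

lemma discrete_rv_pmf:
  assumes "prob_space M" "discrete_rv M X"
  obtains P where "distr M (count_space UNIV) X = measure_pmf P" "\<And>x. rv_pmf M X x = pmf P x"
proof -
  let ?D = "distr M (count_space UNIV) X"
  have X: "X \<in> M \<rightarrow>\<^sub>M count_space UNIV" using assms by (simp add: discrete_rv_def)
  obtain S where S: "countable S" "AE \<omega> in M. X \<omega> \<in> S" using assms by (auto simp: discrete_rv_def)
  interpret D: prob_space ?D by (rule prob_space.prob_space_distr[OF assms(1) X])
  have "AE x in ?D. x \<in> S" using S X by (simp add: AE_distr_iff)
  then have "AE x in ?D. measure ?D {x} \<noteq> 0"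
    using S D.AE_support_countable by auto
  then have D: "measure_pmf (Abs_pmf ?D) = ?D"
    by (intro Abs_pmf_inverse) (auto simp: D.prob_space_axioms)
  have "rv_pmf M X x = pmf (Abs_pmf ?D) x" for x
  proof -
    have "X -` {x} \<inter> space M = {\<omega> \<in> space M. X \<omega> = x}" by auto
    then show ?thesis
      unfolding pmf.rep_eq D by (subst measure_distr[OF X]) (auto simp: rv_pmf_def)
  qed
  from that[OF D[symmetric] this] show ?thesis .
qed

lemma iid_representation_exists:
  fixes r :: "nat pmf" and F :: "(nat \<Rightarrow> nat) \<Rightarrow> 'b"
  assumes P: "distr M (count_space UNIV) X = measure_pmf P"
    and F: "map_pmf F (Pi_pmf {1..n} 0 (\<lambda>_. r)) = P"
    and n: "n \<ge> 1" and B: "pmf_entropy r \<le> B"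
  shows "\<exists>(N :: (nat \<Rightarrow> nat) measure) (Z :: nat \<Rightarrow> (nat \<Rightarrow> nat) \<Rightarrow> nat) (f :: (nat \<Rightarrow> nat) \<Rightarrow> 'b).
    prob_space N \<and> iid_discrete N {1..n} Z \<and>
    same_distribution M X N (\<lambda>\<omega>. f (\<lambda>i\<in>{1..n}. Z i \<omega>)) \<and> shannon_entropy N (Z 1) \<le> B"
proof -
  define Q where "Q = Pi_pmf {1..n} 0 (\<lambda>_. r)"
  \<comment> \<open>\<open>f\<close> receives a restriction, which is \<open>undefined\<close> off
    \<open>{1..n}\<close>; it restores the default \<open>0\<close> that functions in the support of
    \<open>Q\<close> take there.\<close>
  define f where "f g = F (\<lambda>i. if i \<in> {1..n} then g i else 0)" for g :: "nat \<Rightarrow> nat"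
  let ?Z = "\<lambda>i \<omega> :: nat \<Rightarrow> nat. \<omega> i"
  have comp: "map_pmf (?Z i) Q = r" if "i \<in> {1..n}" for i
    unfolding Q_def using that by (subst Pi_pmf_component) auto
  have distr: "distr Q (count_space UNIV) (?Z i) = measure_pmf r" if "i \<in> {1..n}" for i
    using comp[OF that] by (simp flip: map_pmf_rep_eq)
  have "iid_discrete Q {1..n} ?Z"
    unfolding iid_discrete_def discrete_rv_def same_distribution_def
  proof (intro conjI ballI)
    show "prob_space.indep_vars Q (\<lambda>_. count_space UNIV) ?Z {1..n}"
      unfolding Q_def by (rule indep_vars_Pi_pmf) simp
  qed (auto simp: distr intro: exI[of _ UNIV])
  moreover have "same_distribution M X Q (\<lambda>\<omega>. f (\<lambda>i\<in>{1..n}. \<omega> i))"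
  proof -
    have "map_pmf (\<lambda>\<omega>. f (\<lambda>i\<in>{1..n}. \<omega> i)) Q = map_pmf F Q"
    proof (rule map_pmf_cong[OF refl])
      fix \<omega> assume "\<omega> \<in> set_pmf Q"
      then have "\<forall>i. i \<notin> {1..n} \<longrightarrow> \<omega> i = 0"
        using set_Pi_pmf_subset[of "{1..n}" 0 "\<lambda>_. r"] by (auto simp: Q_def)
      then have "(\<lambda>i. if i \<in> {1..n} then (\<lambda>i\<in>{1..n}. \<omega> i) i else 0) = \<omega>" by auto
      then show "f (\<lambda>i\<in>{1..n}. \<omega> i) = F \<omega>" by (simp only: f_def)
    qed
    then have "map_pmf (\<lambda>\<omega>. f (\<lambda>i\<in>{1..n}. \<omega> i)) Q = P" using F by (simp add: Q_def)
    then show ?thesis unfolding same_distribution_def P by (simp flip: map_pmf_rep_eq)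
  qed
  moreover have "shannon_entropy Q (?Z 1) \<le> B"
  proof -
    have "rv_pmf Q (?Z 1) x = pmf r x" for x
      using comp[of 1] n by (auto simp: rv_pmf_def pmf_map vimage_def)
    then show ?thesis using B by (simp add: shannon_entropy_eq_pmf_entropy)
  qed
  moreover have "prob_space (measure_pmf Q)" by (rule prob_space_measure_pmf)
  ultimately show ?thesis by blast
qed

text \<open>Serves \<open>n = 1\<close> and infinite entropy: \<open>X\<close> is coded by naturals,
  and only the first copy is decoded.\<close>

lemma copies_representation:
  fixes P :: "'b pmf"
  assumes "n \<ge> 1"
  obtains r :: "nat pmf" and F :: "(nat \<Rightarrow> nat) \<Rightarrow> 'b"
  where "map_pmf F (Pi_pmf {1..n} 0 (\<lambda>_. r)) = P" "pmf_entropy r = pmf_entropy P"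
proof -
  let ?S = "set_pmf P"
  define r where "r = map_pmf (to_nat_on ?S) P"
  have ent: "pmf_entropy r = pmf_entropy P"
    unfolding r_def by (intro pmf_entropy_map_inj inj_on_to_nat_on countable_set_pmf)
  have "map_pmf (\<lambda>\<omega>. from_nat_into ?S (\<omega> 1)) (Pi_pmf {1..n} 0 (\<lambda>_. r))
      = map_pmf (from_nat_into ?S) (map_pmf (\<lambda>\<omega>. \<omega> 1) (Pi_pmf {1..n} 0 (\<lambda>_. r)))"
    by (simp add: pmf.map_comp o_def)
  also have "\<dots> = map_pmf (from_nat_into ?S) r" using assms by (simp add: Pi_pmf_component)
  also have "\<dots> = map_pmf (\<lambda>x. x) P"
    unfolding r_def pmf.map_comp by (intro map_pmf_cong refl) (simp add: from_nat_into_to_nat_on countable_set_pmf)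
  finally have "map_pmf (\<lambda>\<omega>. from_nat_into ?S (\<omega> 1)) (Pi_pmf {1..n} 0 (\<lambda>_. r)) = P" by simp
  from that[OF this ent] show ?thesis .
qed

text \<open>Each component pairs a greedy atom with a root-geometric value, so the entropies add.
  The atoms together form the cell, and the maximum of the other parts is the geometric variable
  that supplies the coin.\<close>

lemma small_component_representation:
  fixes P :: "'b pmf" and n :: nat
  assumes n: "n \<ge> 1" and H: "pmf_entropy P = ennreal H" "H \<ge> 0"
  defines "\<phi> \<equiv> 1 / (1 - (1 - 1 / n) ^ n)"
  obtains r :: "nat pmf" and F :: "(nat \<Rightarrow> nat) \<Rightarrow> 'b" and w0 :: real
  where "map_pmf F (Pi_pmf {1..n} 0 (\<lambda>_. r)) = P"
    "pmf_entropy r \<le> ennreal (\<phi> * (H / n) + binary_entropy w0) + pmf_entropy (root_geometric_pmf n)"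
    "(1 - w0)\<^sup>2 * log 2 (exp 1) \<le> \<phi> * (H / n)" "0 \<le> w0" "w0 \<le> 1"
proof -
  have "\<exists>w. greedy_atoms (component_bound P n) w"
    using component_bound_antimono[OF n] component_bound_pos[OF n] component_bound_eq_0[OF n]
    by (intro greedy_atoms_exist) auto
  then obtain w where w: "greedy_atoms (component_bound P n) w" ..
  then have w_nonneg: "w k \<ge> 0" and w_sums: "w sums 1" for k
    by (auto simp: greedy_atoms_def)
  define W where "W = embed_pmf w"
  have W: "pmf W k = w k" for k
    unfolding W_def
  proof (rule pmf_embed_pmf)
    show "(\<integral>\<^sup>+k. ennreal (w k) \<partial>count_space UNIV) = 1"
      using suminf_ennreal_eq[OF w_nonneg w_sums] by (simp add: nn_integral_count_space_nat)
  qed (rule w_nonneg)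
  let ?g = "root_geometric_pmf n" and ?A = "{1..n}"
  define C where "C = Pi_pmf ?A 0 (\<lambda>_. W)"
  have "measure_pmf.prob C {j. pmf C j > l} \<le> measure_pmf.prob P {x. pmf P x > l}" if "l \<ge> 0" for l
    unfolding C_def by (rule prob_product_le_upper_prob[OF n w W that])
  then obtain f where f: "map_pmf f (pair_pmf C (geometric_pmf (1 / 2))) = P"
    using pmf_from_finer_pmf_and_geometric[of C P] by blast
  define r where "r = map_pmf prod_encode (pair_pmf W ?g)"
  define F where "F \<omega> = (let h = prod_decode \<circ> \<omega> in f (fst \<circ> h, Max ((snd \<circ> h) ` ?A)))" for \<omega>
  \<comment> \<open>Encoding commutes with \<open>Pi_pmf\<close> because
    \<open>prod_encode (0, 0) = 0\<close> matches the defaults.\<close>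
  have "Pi_pmf ?A 0 (\<lambda>_. r) = map_pmf (\<lambda>h. prod_encode \<circ> h) (Pi_pmf ?A (0, 0) (\<lambda>_. pair_pmf W ?g))"
    unfolding r_def by (rule Pi_pmf_map) (auto simp: prod_encode_def)
  then have "map_pmf F (Pi_pmf ?A 0 (\<lambda>_. r))
      = map_pmf (\<lambda>h. f (fst \<circ> h, Max ((snd \<circ> h) ` ?A))) (Pi_pmf ?A (0, 0) (\<lambda>_. pair_pmf W ?g))"
    by (simp add: pmf.map_comp o_def F_def)
  also have "\<dots> = map_pmf f (map_pmf (\<lambda>(j, g). (j, Max (g ` ?A)))
      (map_pmf (\<lambda>h. (fst \<circ> h, snd \<circ> h)) (Pi_pmf ?A (0, 0) (\<lambda>_. pair_pmf W ?g))))"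
    by (simp add: pmf.map_comp o_def)
  also have "\<dots> = map_pmf f (map_pmf (\<lambda>(j, g). (id j, Max (g ` ?A))) (pair_pmf C (Pi_pmf ?A 0 (\<lambda>_. ?g))))"
    by (simp add: Pi_pmf_pair_pmf C_def)
  also have "\<dots> = map_pmf f (pair_pmf C (geometric_pmf (1 / 2)))"
    by (simp only: map_pair Max_root_geometric[OF n] pmf.map_id)
  finally have "map_pmf F (Pi_pmf ?A 0 (\<lambda>_. r)) = P" by (simp add: f)
  moreover have "pmf_entropy r = pmf_entropy W + pmf_entropy ?g"
    unfolding r_def by (simp add: pmf_entropy_map_inj[OF inj_prod_encode] pmf_entropy_pair)
  then have "pmf_entropy r \<le> ennreal (\<phi> * (H / n) + binary_entropy (w 0)) + pmf_entropy ?g"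
    using entropy_of_greedy_atoms(1)[OF n w W H] by (simp add: \<phi>_def add_right_mono)
  moreover have "(1 - w 0)\<^sup>2 * log 2 (exp 1) \<le> \<phi> * (H / n)"
    unfolding \<phi>_def by (rule entropy_of_greedy_atoms(2)[OF n w W H])
  moreover have "0 \<le> w 0" "w 0 \<le> 1"
    using entropy_of_greedy_atoms(3)[OF n w W H] by simp_all
  ultimately show ?thesis by (rule that)
qed

section \<open>Constants of the final bound\<close>

lemma one_minus_inverse_power_le: "n \<ge> 1 \<Longrightarrow> (1 - 1 / real n) ^ n \<le> exp (- 1)"
proof -
  assume n: "n \<ge> 1"
  have "(1 - 1 / n) ^ n \<le> exp (- (1 / n)) ^ n"
    using n exp_ge_add_one_self[of "- (1 / n)"] by (intro power_mono) auto
  also have "\<dots> = exp (- 1)" using n by (simp flip: exp_of_nat_mult)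
  finally show ?thesis .
qed

text \<open>The leading factor is at most \<open>exp 1 / (exp 1 - 1)\<close>, which bounds
  \<open>1 - w\<close> by the square root. Binary entropy is symmetric and increases up to
  \<open>1 / 2\<close>; past that point its maximum \<open>1\<close> is used.\<close>

lemma binary_entropy_le_sqrt_bound:
  fixes n :: nat
  assumes n: "n \<ge> 1" and h: "h \<ge> 0" and w: "0 \<le> w" "w \<le> 1"
    and le: "(1 - w)\<^sup>2 * log 2 (exp 1) \<le> 1 / (1 - (1 - 1 / n) ^ n) * h"
  shows "binary_entropy w \<le> binary_entropy (min (sqrt (exp 1 / ((exp 1 - 1) * log 2 (exp 1)) * h)) (1 / 2))"
proof -
  let ?e = "log 2 (exp 1)" and ?s = "sqrt (exp 1 / ((exp 1 - 1) * log 2 (exp 1)) * h)"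
  have e: "?e > 0" by simp
  have "exp (- 1) < (1 :: real)" by simp
  then have "1 / (1 - (1 - 1 / n) ^ n) \<le> 1 / (1 - exp (- 1))"
    using one_minus_inverse_power_le[OF n] by (intro divide_left_mono mult_pos_pos) linarith+
  also have "\<dots> = exp 1 / (exp 1 - 1)" by (simp add: exp_minus field_simps)
  finally have "1 / (1 - (1 - 1 / n) ^ n) * h \<le> exp 1 / (exp 1 - 1) * h"
    using h by (intro mult_right_mono) auto
  with le have "(1 - w)\<^sup>2 * ?e \<le> exp 1 / (exp 1 - 1) * h" by linarith
  then have "(1 - w)\<^sup>2 \<le> exp 1 / (exp 1 - 1) * h / ?e" using e by (simp only: pos_le_divide_eq)
  also have "\<dots> = exp 1 / ((exp 1 - 1) * ?e) * h" by simp
  finally have "1 - w \<le> ?s" by (rule real_le_rsqrt)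
  then have "binary_entropy (1 - w) \<le> binary_entropy (min ?s (1 / 2))"
  proof (cases "1 - w \<le> 1 / 2")
    case True
    with \<open>1 - w \<le> ?s\<close> w show ?thesis by (intro binary_entropy_mono) auto
  next
    case False
    with \<open>1 - w \<le> ?s\<close> have "min ?s (1 / 2) = 1 / 2" by simp
    then show ?thesis using w binary_entropy_le_1[of "1 - w"] by (simp only: binary_entropy_half)
  qed
  then show ?thesis by (simp add: binary_entropy_sym)
qed

theorem theorem10:
  fixes M :: "'a measure" and X :: "'a \<Rightarrow> 'b" and n :: nat
  assumes "prob_space M" and "discrete_rv M X" and "n \<ge> 1"
  shows "\<exists>(N :: (nat \<Rightarrow> nat) measure) (Z :: nat \<Rightarrow> (nat \<Rightarrow> nat) \<Rightarrow> nat) (f :: (nat \<Rightarrow> nat) \<Rightarrow> 'b).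
    prob_space N \<and>
    iid_discrete N {1..n} Z \<and>
    same_distribution M X N (\<lambda>\<omega>. f (\<lambda>i\<in>{1..n}. Z i \<omega>)) \<and>
    shannon_entropy N (Z 1) \<le>
      ennreal (1 / (1 - (1 - 1 / real n) ^ n)) * (shannon_entropy M X / of_nat n) +
      ennreal (min 2.43
        (binary_entropy (enn2real (min
            (ennreal_sqrt (ennreal (exp 1 / ((exp 1 - 1) * log 2 (exp 1))) *
               (shannon_entropy M X / of_nat n)))
            (ennreal (1 / 2))))
         + binary_entropy (2 powr (- 1 / real n)) + 2 * (1 - 2 powr (- 1 / real n))))"
    (is "\<exists>N Z f. _ \<and> _ \<and> _ \<and> _ \<le> ?B")
proof -
  obtain P where P: "distr M (count_space UNIV) X = measure_pmf P" "\<And>x. rv_pmf M X x = pmf P x"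
    by (rule discrete_rv_pmf[OF assms(1,2)]) (rule that; blast)
  have HX: "shannon_entropy M X = pmf_entropy P"
    using P(2) by (rule shannon_entropy_eq_pmf_entropy)
  define \<phi> where "\<phi> = 1 / (1 - (1 - 1 / real n) ^ n)"
  have "(1 - 1 / real n) ^ n < 1"
    using le_less_trans[OF one_minus_inverse_power_le[OF assms(3)], of 1] by simp
  then have \<phi>: "\<phi> > 0" by (simp add: \<phi>_def)
  show ?thesis
  \<comment> \<open>For \<open>n = 1\<close> the leading factor is \<open>1\<close>, and for
    infinite entropy the bound is infinite. The constant 1.43 is available only from
    \<open>n = 2\<close> on.\<close>
  proof (cases "n = 1 \<or> pmf_entropy P = \<infinity>")
    case True
    then have "pmf_entropy P \<le> ?B"
    proof
      assume "n = 1"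
      then have "ennreal \<phi> * (pmf_entropy P / of_nat n) = pmf_entropy P"
        using divide_ennreal[of _ 1] by (cases "pmf_entropy P") (auto simp: \<phi>_def ennreal_top_divide)
      then show ?thesis unfolding HX \<phi>_def[symmetric] by simp
    next
      assume inf: "pmf_entropy P = \<infinity>"
      have "ennreal \<phi> * (pmf_entropy P / of_nat n) = \<infinity>"
        using \<phi> by (simp add: inf ennreal_top_divide ennreal_mult_top)
      then show ?thesis unfolding HX \<phi>_def[symmetric] by simp
    qed
    moreover obtain r :: "nat pmf" and F :: "(nat \<Rightarrow> nat) \<Rightarrow> 'b"
      where r: "map_pmf F (Pi_pmf {1..n} 0 (\<lambda>_. r)) = P" "pmf_entropy r = pmf_entropy P"
      by (rule copies_representation[OF assms(3)])
    ultimately have "pmf_entropy r \<le> ?B" by (simp only:)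
    then show ?thesis by (rule iid_representation_exists[OF P(1) r(1) assms(3)])
  next
    case False
    then have n: "n \<ge> 2" using assms(3) by simp
    obtain H where H: "pmf_entropy P = ennreal H" "H \<ge> 0"
      using False by (cases "pmf_entropy P") auto
    let ?b = "binary_entropy (2 powr (- 1 / real n)) + 2 * (1 - 2 powr (- 1 / real n))"
    let ?m = "min (sqrt (exp 1 / ((exp 1 - 1) * log 2 (exp 1)) * (H / n))) (1 / 2)"
    obtain r :: "nat pmf" and F :: "(nat \<Rightarrow> nat) \<Rightarrow> 'b" and w0 where r: "map_pmf F (Pi_pmf {1..n} 0 (\<lambda>_. r)) = P"
      "pmf_entropy r \<le> ennreal (\<phi> * (H / n) + binary_entropy w0) + pmf_entropy (root_geometric_pmf n)"
      "(1 - w0)\<^sup>2 * log 2 (exp 1) \<le> \<phi> * (H / n)" "0 \<le> w0" "w0 \<le> 1"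
      by (rule small_component_representation[OF assms(3) H, folded \<phi>_def])
    have h: "H / n \<ge> 0" using H by simp
    then have \<phi>h: "\<phi> * (H / n) \<ge> 0" using \<phi> by (intro mult_nonneg_nonneg) auto
    have w0: "binary_entropy w0 \<ge> 0" "binary_entropy w0 \<le> 1" "binary_entropy w0 \<le> binary_entropy ?m"
      using binary_entropy_nonneg[OF r(4,5)] binary_entropy_le_1[OF r(4,5)]
        binary_entropy_le_sqrt_bound[OF assms(3) h r(4,5) r(3)[unfolded \<phi>_def]] by simp_all
    have "0 < 2 powr (- 1 / real n)" "2 powr (- 1 / real n) \<le> 1"
      using powr_mono[of "- 1 / real n" 0 2] by simp_all
    then have b: "?b \<ge> 0" using binary_entropy_nonneg[of "2 powr (- 1 / real n)"] by simp
    have "pmf_entropy (root_geometric_pmf n) \<le> min (ennreal 1.43) (ennreal ?b)"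
      using root_geometric_entropy_le_const[OF n] root_geometric_entropy_le_doubled[OF assms(3)] by simp
    also have "\<dots> = ennreal (min 1.43 ?b)" using b by (intro min_ennreal) auto
    finally have "pmf_entropy r \<le> ennreal (\<phi> * (H / n) + binary_entropy w0) + ennreal (min 1.43 ?b)"
      using r(2) add_left_mono order_trans by blast
    also have "\<dots> = ennreal (\<phi> * (H / n) + (binary_entropy w0 + min 1.43 ?b))"
      using \<phi>h w0(1) b by (subst ennreal_plus[symmetric]) (auto simp: add.assoc)
    also have "\<dots> \<le> ennreal (\<phi> * (H / n) + min 2.43 (binary_entropy ?m + ?b))"
    proof (intro ennreal_leI add_left_mono)
      \<comment> \<open>The constant 2.43 is 1.43 for the root-geometric part plus at most one bit
        for \<open>binary_entropy w0\<close>.\<close>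
      have "x + min 1.43 b \<le> min 2.43 (y + b)" if "x \<le> 1" "x \<le> y" for x y b :: real
        using that by (auto simp: min_def)
      then show "binary_entropy w0 + min 1.43 ?b \<le> min 2.43 (binary_entropy ?m + ?b)"
        using w0(2,3) .
    qed
    also have "\<dots> = ennreal \<phi> * ennreal (H / n) + ennreal (min 2.43 (binary_entropy ?m + ?b))"
      unfolding ennreal_mult[OF less_imp_le[OF \<phi>] h, symmetric]
      using \<phi>h w0 b by (intro ennreal_plus) auto
    also have "\<dots> = ?B"
    proof -
      have Hn: "shannon_entropy M X / of_nat n = ennreal (H / n)"
        using assms(3) H by (simp add: HX ennreal_of_nat_eq_real_of_nat divide_ennreal)
      have c: "exp 1 / ((exp 1 - 1) * log 2 (exp 1)) \<ge> (0 :: real)" by simp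
      have "ennreal_sqrt (ennreal (exp 1 / ((exp 1 - 1) * log 2 (exp 1))) * ennreal (H / n))
          = ennreal (sqrt (exp 1 / ((exp 1 - 1) * log 2 (exp 1)) * (H / n)))"
        unfolding ennreal_mult[OF c h, symmetric] ennreal_sqrt_def
        using mult_nonneg_nonneg[OF c h] by (simp only: enn2real_ennreal) simp
      moreover have "min (ennreal (sqrt (exp 1 / ((exp 1 - 1) * log 2 (exp 1)) * (H / n)))) (ennreal (1 / 2)) = ennreal ?m"
        using mult_nonneg_nonneg[OF c h] by (intro min_ennreal) auto
      moreover have "enn2real (ennreal ?m) = ?m"
        using mult_nonneg_nonneg[OF c h] by (intro enn2real_ennreal) auto
      ultimately show ?thesis unfolding Hn \<phi>_def by (simp only: add.assoc)
    qed
    finally have "pmf_entropy r \<le> ?B" .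
    then show ?thesis by (rule iid_representation_exists[OF P(1) r(1) assms(3)])
  qed
qed

end
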